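(* Let $\mathbf{k}$ be a commutative ring. There is a graded $\mathbf{k}$-Hopf algebra $H$ such that the family $$(p_{\alpha,\sigma})_{k\in\mathbb{N};\ \alpha\text{ is a weak composition of length }k;\ \sigma\in\mathfrak{S}_k}$$ of endomorphisms of $H$ is $\mathbf{k}$-linearly independent, and such that each graded component $H_n$ is a free $\mathbf{k}$-module.
   Context: $\mathbb{N}=\{0,1,2,\ldots\}$; $[k]=\{1,2,\ldots,k\}$; $\mathfrak{S}_k$ is the group of permutations of $[k]$. All structures are over the commutative ring $\mathbf{k}$. "Graded" means $\mathbb{N}$-graded; a graded bialgebra $H=\bigoplus_{n\in\mathbb{N}}H_n$ is a bialgebra whose multiplication, unit, comultiplication and counit are graded maps (no sign twists in tensor products); a graded Hopf algebra is a graded bialgebra with a (graded) antipode. It is not required to be connected. $p_n:H\to H$ is the canonical projection onto the $n$-th graded component $H_n$. The maps $m^{[k]}:H^{\otimes k}\to H$ and $\Delta^{[k]}:H\to H^{\otimes k}$ are the $k$-fold iterated multiplication and comultiplication ($m^{[0]}=u$ is the unit map, $\Delta^{[0]}=\epsilon$ is the counit). The group $\mathfrak{S}_k$ acts on $H^{\otimes k}$ from the left by $\sigma\cdot(h_1\otimes\cdots\otimes h_k)=h_{\sigma^{-1}(1)}\otimes\cdots\otimes h_{\sigma^{-1}(k)}$. A weak composition is a finite tuple of nonnegative integers; its length is its number of entries. For $\alpha=(\alpha_1,\ldots,\alpha_k)\in\mathbb{N}^k$, let $P_\alpha:=p_{\alpha_1}\otimes\cdots\otimes p_{\alpha_k}$.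 For $\alpha\in\mathbb{N}^k$ and $\sigma\in\mathfrak{S}_k$, define $p_{\alpha,\sigma}:=m^{[k]}\circ P_\alpha\circ\sigma^{-1}\circ\Delta^{[k]}:H\to H$, where $\sigma^{-1}$ means the action of $\sigma^{-1}$ on $H^{\otimes k}$. *)

theory Defs
  imports "HOL-Library.Poly_Mapping" "HOL-Library.Function_Algebras"
    "HOL-Combinatorics.Permutations"
begin

text \<open>
  The base ring is a type of sort \<open>{comm_ring, comm_monoid_mult}\<close>: these are exactly the
  commutative rings with unit. The class \<open>comm_ring_1\<close>, on which the library locale
  \<open>module\<close> is built, additionally requires \<open>0 \<noteq> 1\<close> and so excludes the zero ring; this is why
  the few notions of linear algebra needed below are restated here.
\<close>

section \<open>Modules\<close>

locale k_module =
  fixes s :: "'k::{comm_ring,comm_monoid_mult} \<Rightarrow> 'm::ab_group_add \<Rightarrow> 'm"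
  assumes scale_right_distrib: "s c (x + y) = s c x + s c y"
    and scale_left_distrib: "s (c + d) x = s c x + s d x"
    and scale_scale: "s c (s d x) = s (c * d) x"
    and scale_one: "s 1 x = x"

definition is_submodule ::
    "('k::{comm_ring,comm_monoid_mult} \<Rightarrow> 'm::ab_group_add \<Rightarrow> 'm) \<Rightarrow> 'm set \<Rightarrow> bool" where
  "is_submodule s M \<longleftrightarrow>
     0 \<in> M \<and> (\<forall>x\<in>M. \<forall>y\<in>M. x + y \<in> M) \<and> (\<forall>c. \<forall>x\<in>M. s c x \<in> M)"

definition lin_span ::
    "('k::{comm_ring,comm_monoid_mult} \<Rightarrow> 'm::ab_group_add \<Rightarrow> 'm) \<Rightarrow> 'm set \<Rightarrow> 'm set" where
  "lin_span s B = {\<Sum>b\<in>F. s (c b) b | F c. finite F \<and> F \<subseteq> B}"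

definition lin_indep ::
    "('k::{comm_ring,comm_monoid_mult} \<Rightarrow> 'm::ab_group_add \<Rightarrow> 'm) \<Rightarrow> 'i set \<Rightarrow> ('i \<Rightarrow> 'm) \<Rightarrow> bool"
  where
  "lin_indep s I f \<longleftrightarrow>
     (\<forall>F c. finite F \<longrightarrow> F \<subseteq> I \<longrightarrow> (\<Sum>i\<in>F. s (c i) (f i)) = 0 \<longrightarrow> (\<forall>i\<in>F. c i = 0))"

text \<open>Freeness of a submodule \<open>M\<close> of the ambient module.\<close>

definition is_free ::
    "('k::{comm_ring,comm_monoid_mult} \<Rightarrow> 'm::ab_group_add \<Rightarrow> 'm) \<Rightarrow> 'm set \<Rightarrow> bool" where
  "is_free s M \<longleftrightarrow> (\<exists>B. lin_indep s B (\<lambda>b. b) \<and> lin_span s B = M)"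

text \<open>
  \<open>'x \<Rightarrow>\<^sub>0 'k\<close> is the free module on \<open>'x\<close>, and \<open>lin_ext s f\<close> is the linear extension of
  \<open>f\<close> from the basis \<open>'x\<close> to this module.
\<close>

definition fscale :: "'k::{comm_ring,comm_monoid_mult} \<Rightarrow> ('x \<Rightarrow>\<^sub>0 'k) \<Rightarrow> ('x \<Rightarrow>\<^sub>0 'k)" where
  "fscale c u = Poly_Mapping.map (\<lambda>y. c * y) u"

definition lin_ext ::
    "('k::{comm_ring,comm_monoid_mult} \<Rightarrow> 'm::ab_group_add \<Rightarrow> 'm) \<Rightarrow> ('x \<Rightarrow> 'm) \<Rightarrow> ('x \<Rightarrow>\<^sub>0 'k) \<Rightarrow> 'm"
  where
  "lin_ext s f u = (\<Sum>x\<in>Poly_Mapping.keys u. s (Poly_Mapping.lookup u x) (f x))"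


section \<open>Tensor powers\<close>

text \<open>
  The \<open>n\<close>-th tensor power of a module \<open>(H, s)\<close> is the free module on the words of length \<open>n\<close>
  over \<open>H\<close> modulo the relations of multilinearity. A tensor is thus a coset, of type
  \<open>('h list \<Rightarrow>\<^sub>0 'k) set\<close>.
\<close>

definition word_sums :: "nat \<Rightarrow> ('h list \<Rightarrow>\<^sub>0 'k::{comm_ring,comm_monoid_mult}) set" where
  "word_sums n = {u. \<forall>hs\<in>Poly_Mapping.keys u. length hs = n}"

definition multilin_rels ::
    "('k::{comm_ring,comm_monoid_mult} \<Rightarrow> 'h::ab_group_add \<Rightarrow> 'h) \<Rightarrow> nat \<Rightarrow> ('h list \<Rightarrow>\<^sub>0 'k) set"
  where
  "multilin_rels s n = lin_span fscale
     ({Poly_Mapping.single (xs @ [a + b] @ ys) 1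
         - Poly_Mapping.single (xs @ [a] @ ys) 1 - Poly_Mapping.single (xs @ [b] @ ys) 1
       | xs ys a b. length xs + 1 + length ys = n}
      \<union> {Poly_Mapping.single (xs @ [s c a] @ ys) 1 - Poly_Mapping.single (xs @ [a] @ ys) c
       | xs ys c a. length xs + 1 + length ys = n})"

definition tensor_eq ::
    "('k::{comm_ring,comm_monoid_mult} \<Rightarrow> 'h::ab_group_add \<Rightarrow> 'h) \<Rightarrow> nat
      \<Rightarrow> (('h list \<Rightarrow>\<^sub>0 'k) \<times> ('h list \<Rightarrow>\<^sub>0 'k)) set" where
  "tensor_eq s n =
     {(u, v). u \<in> word_sums n \<and> v \<in> word_sums n \<and> u - v \<in> multilin_rels s n}"

definition tensor_power ::
    "('k::{comm_ring,comm_monoid_mult} \<Rightarrow> 'h::ab_group_add \<Rightarrow> 'h) \<Rightarrow> nat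
      \<Rightarrow> ('h list \<Rightarrow>\<^sub>0 'k) set set" where
  "tensor_power s n = word_sums n // tensor_eq s n"

definition tclass ::
    "('k::{comm_ring,comm_monoid_mult} \<Rightarrow> 'h::ab_group_add \<Rightarrow> 'h) \<Rightarrow> nat
      \<Rightarrow> ('h list \<Rightarrow>\<^sub>0 'k) \<Rightarrow> ('h list \<Rightarrow>\<^sub>0 'k) set" where
  "tclass s n u = tensor_eq s n `` {u}"

definition trep :: "('h list \<Rightarrow>\<^sub>0 'k::{comm_ring,comm_monoid_mult}) set \<Rightarrow> ('h list \<Rightarrow>\<^sub>0 'k)" where
  "trep X = (SOME u. u \<in> X)"

text \<open>\<open>pure s [h\<^sub>1, \<dots>, h\<^sub>n]\<close> is the pure tensor of \<open>h\<^sub>1, \<dots>, h\<^sub>n\<close>.\<close>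

definition pure ::
    "('k::{comm_ring,comm_monoid_mult} \<Rightarrow> 'h::ab_group_add \<Rightarrow> 'h) \<Rightarrow> 'h list \<Rightarrow> ('h list \<Rightarrow>\<^sub>0 'k) set"
  where
  "pure s hs = tclass s (length hs) (Poly_Mapping.single hs 1)"

definition tadd ::
    "('k::{comm_ring,comm_monoid_mult} \<Rightarrow> 'h::ab_group_add \<Rightarrow> 'h) \<Rightarrow> nat
      \<Rightarrow> ('h list \<Rightarrow>\<^sub>0 'k) set \<Rightarrow> ('h list \<Rightarrow>\<^sub>0 'k) set \<Rightarrow> ('h list \<Rightarrow>\<^sub>0 'k) set" where
  "tadd s n X Y = tclass s n (trep X + trep Y)"

definition tscale ::
    "('k::{comm_ring,comm_monoid_mult} \<Rightarrow> 'h::ab_group_add \<Rightarrow> 'h) \<Rightarrow> nat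
      \<Rightarrow> 'k \<Rightarrow> ('h list \<Rightarrow>\<^sub>0 'k) set \<Rightarrow> ('h list \<Rightarrow>\<^sub>0 'k) set" where
  "tscale s n c X = tclass s n (fscale c (trep X))"

text \<open>
  For \<open>G\<close> multilinear on words of length \<open>m\<close> with values in the \<open>n\<close>-th tensor power,
  \<open>tmap s n G\<close> is the linear map between tensor powers sending the pure tensor of \<open>hs\<close> to
  \<open>G hs\<close>; similarly, \<open>teval s f\<close> is the linear map into \<open>H\<close> itself that a multilinear \<open>f\<close>
  with values in \<open>H\<close> induces. Multilinearity makes the results independent of the chosen
  representatives.
\<close>

definition tmap ::
    "('k::{comm_ring,comm_monoid_mult} \<Rightarrow> 'h::ab_group_add \<Rightarrow> 'h) \<Rightarrow> nat
      \<Rightarrow> ('h list \<Rightarrow> ('h list \<Rightarrow>\<^sub>0 'k) set) \<Rightarrow> ('h list \<Rightarrow>\<^sub>0 'k) set \<Rightarrow> ('h list \<Rightarrow>\<^sub>0 'k) set" where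
  "tmap s n G X = tclass s n (lin_ext fscale (\<lambda>hs. trep (G hs)) (trep X))"

definition teval ::
    "('k::{comm_ring,comm_monoid_mult} \<Rightarrow> 'h::ab_group_add \<Rightarrow> 'h)
      \<Rightarrow> ('h list \<Rightarrow> 'h) \<Rightarrow> ('h list \<Rightarrow>\<^sub>0 'k) set \<Rightarrow> 'h" where
  "teval s f X = lin_ext s f (trep X)"

text \<open>The tensor product of two tensors; \<open>n\<close> is the sum of their lengths.\<close>

definition totimes ::
    "('k::{comm_ring,comm_monoid_mult} \<Rightarrow> 'h::ab_group_add \<Rightarrow> 'h) \<Rightarrow> nat
      \<Rightarrow> ('h list \<Rightarrow>\<^sub>0 'k) set \<Rightarrow> ('h list \<Rightarrow>\<^sub>0 'k) set \<Rightarrow> ('h list \<Rightarrow>\<^sub>0 'k) set" where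
  "totimes s n X Y = tmap s n (\<lambda>xs. tmap s n (\<lambda>ys. pure s (xs @ ys)) Y) X"


section \<open>Graded Hopf algebras\<close>

text \<open>The underlying module is the whole type \<open>'h\<close> with its own addition.\<close>

record (overloaded) ('k, 'h) hopf_data =
  hscale :: "'k \<Rightarrow> 'h \<Rightarrow> 'h"
  hmult :: "'h \<Rightarrow> 'h \<Rightarrow> 'h"
  hone :: "'h"
  hcomult :: "'h \<Rightarrow> ('h list \<Rightarrow>\<^sub>0 'k) set"
  hcounit :: "'h \<Rightarrow> 'k"
  hantipode :: "'h \<Rightarrow> 'h"
  hcomp :: "nat \<Rightarrow> 'h set"

definition homogeneous_decomp ::
    "('k::{comm_ring,comm_monoid_mult}, 'h::ab_group_add) hopf_data \<Rightarrow> 'h \<Rightarrow> (nat \<Rightarrow>\<^sub>0 'h) \<Rightarrow> bool"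
  where
  "homogeneous_decomp A x f \<longleftrightarrow>
     (\<forall>n. Poly_Mapping.lookup f n \<in> hcomp A n) \<and>
     x = (\<Sum>n\<in>Poly_Mapping.keys f. Poly_Mapping.lookup f n)"

definition proj ::
    "('k::{comm_ring,comm_monoid_mult}, 'h::ab_group_add) hopf_data \<Rightarrow> nat \<Rightarrow> 'h \<Rightarrow> 'h" where
  "proj A n x = Poly_Mapping.lookup (THE f. homogeneous_decomp A x f) n"

locale graded_module = k_module "hscale A"
  for A :: "('k::{comm_ring,comm_monoid_mult}, 'h::ab_group_add) hopf_data" +
  assumes comp_submodule: "is_submodule (hscale A) (hcomp A n)"
    and comp_direct_sum: "\<exists>!f. homogeneous_decomp A x f"

locale graded_algebra = graded_module A
  for A :: "('k::{comm_ring,comm_monoid_mult}, 'h::ab_group_add) hopf_data" +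
  assumes mult_add_left: "hmult A (x + y) z = hmult A x z + hmult A y z"
    and mult_add_right: "hmult A x (y + z) = hmult A x y + hmult A x z"
    and mult_scale_left: "hmult A (hscale A c x) y = hscale A c (hmult A x y)"
    and mult_scale_right: "hmult A x (hscale A c y) = hscale A c (hmult A x y)"
    and mult_assoc: "hmult A (hmult A x y) z = hmult A x (hmult A y z)"
    and one_left: "hmult A (hone A) x = x"
    and one_right: "hmult A x (hone A) = x"
    and mult_graded: "x \<in> hcomp A i \<Longrightarrow> y \<in> hcomp A j \<Longrightarrow> hmult A x y \<in> hcomp A (i + j)"
    and one_graded: "hone A \<in> hcomp A 0"

text \<open>
  The \<open>n\<close>-th graded component of \<open>H \<otimes> H\<close> is the sum of the \<open>H\<^sub>i \<otimes> H\<^sub>j\<close> with \<open>i + j = n\<close>.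
\<close>

definition tensor_square_comp ::
    "('k::{comm_ring,comm_monoid_mult}, 'h::ab_group_add) hopf_data \<Rightarrow> nat
      \<Rightarrow> ('h list \<Rightarrow>\<^sub>0 'k) set set" where
  "tensor_square_comp A n = {tclass (hscale A) 2 u | u. \<forall>hs\<in>Poly_Mapping.keys u.
     \<exists>a b i j. hs = [a, b] \<and> a \<in> hcomp A i \<and> b \<in> hcomp A j \<and> i + j = n}"

locale graded_coalgebra = graded_module A
  for A :: "('k::{comm_ring,comm_monoid_mult}, 'h::ab_group_add) hopf_data" +
  assumes comult_in: "hcomult A x \<in> tensor_power (hscale A) 2"
    and comult_add: "hcomult A (x + y) = tadd (hscale A) 2 (hcomult A x) (hcomult A y)"
    and comult_scale: "hcomult A (hscale A c x) = tscale (hscale A) 2 c (hcomult A x)"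
    and counit_add: "hcounit A (x + y) = hcounit A x + hcounit A y"
    and counit_scale: "hcounit A (hscale A c x) = c * hcounit A x"
    and coassoc:
      "tmap (hscale A) 3
         (\<lambda>hs. totimes (hscale A) 3 (hcomult A (hs ! 0)) (pure (hscale A) [hs ! 1])) (hcomult A x)
       = tmap (hscale A) 3
         (\<lambda>hs. totimes (hscale A) 3 (pure (hscale A) [hs ! 0]) (hcomult A (hs ! 1))) (hcomult A x)"
    and counit_left:
      "teval (hscale A) (\<lambda>hs. hscale A (hcounit A (hs ! 0)) (hs ! 1)) (hcomult A x) = x"
    and counit_right:
      "teval (hscale A) (\<lambda>hs. hscale A (hcounit A (hs ! 1)) (hs ! 0)) (hcomult A x) = x"
    and comult_graded: "x \<in> hcomp A n \<Longrightarrow> hcomult A x \<in> tensor_square_comp A n"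
    and counit_graded: "x \<in> hcomp A n \<Longrightarrow> n \<noteq> 0 \<Longrightarrow> hcounit A x = 0"

text \<open>The product \<open>(a \<otimes> b)(c \<otimes> d) = ac \<otimes> bd\<close> of \<open>H \<otimes> H\<close>.\<close>

definition tensor_square_mult ::
    "('k::{comm_ring,comm_monoid_mult}, 'h::ab_group_add) hopf_data
      \<Rightarrow> ('h list \<Rightarrow>\<^sub>0 'k) set \<Rightarrow> ('h list \<Rightarrow>\<^sub>0 'k) set \<Rightarrow> ('h list \<Rightarrow>\<^sub>0 'k) set" where
  "tensor_square_mult A X Y =
     tmap (hscale A) 2 (\<lambda>xs. tmap (hscale A) 2
       (\<lambda>ys. pure (hscale A) [hmult A (xs ! 0) (ys ! 0), hmult A (xs ! 1) (ys ! 1)]) Y) X"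

locale graded_bialgebra = graded_algebra A + graded_coalgebra A
  for A :: "('k::{comm_ring,comm_monoid_mult}, 'h::ab_group_add) hopf_data" +
  assumes comult_mult:
      "hcomult A (hmult A x y) = tensor_square_mult A (hcomult A x) (hcomult A y)"
    and comult_one: "hcomult A (hone A) = pure (hscale A) [hone A, hone A]"
    and counit_mult: "hcounit A (hmult A x y) = hcounit A x * hcounit A y"
    and counit_one: "hcounit A (hone A) = 1"

locale graded_hopf_algebra = graded_bialgebra A
  for A :: "('k::{comm_ring,comm_monoid_mult}, 'h::ab_group_add) hopf_data" +
  assumes antipode_add: "hantipode A (x + y) = hantipode A x + hantipode A y"
    and antipode_scale: "hantipode A (hscale A c x) = hscale A c (hantipode A x)"
    and antipode_left:
      "teval (hscale A) (\<lambda>hs. hmult A (hantipode A (hs ! 0)) (hs ! 1)) (hcomult A x)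
       = hscale A (hcounit A x) (hone A)"
    and antipode_right:
      "teval (hscale A) (\<lambda>hs. hmult A (hs ! 0) (hantipode A (hs ! 1))) (hcomult A x)
       = hscale A (hcounit A x) (hone A)"
    and antipode_graded: "x \<in> hcomp A n \<Longrightarrow> hantipode A x \<in> hcomp A n"


section \<open>The endomorphisms \<open>p\<^sub>\<alpha>\<^sub>,\<^sub>\<sigma>\<close>\<close>

definition iter_mult ::
    "('k::{comm_ring,comm_monoid_mult}, 'h::ab_group_add) hopf_data
      \<Rightarrow> ('h list \<Rightarrow>\<^sub>0 'k) set \<Rightarrow> 'h" where
  "iter_mult A = teval (hscale A) (\<lambda>hs. foldr (hmult A) hs (hone A))"

text \<open>
  The \<open>k\<close>-fold comultiplication. The \<open>0\<close>-th tensor power is the base ring, with the pure tensor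
  of the empty word as \<open>1\<close>.
\<close>

fun iter_comult ::
    "('k::{comm_ring,comm_monoid_mult}, 'h::ab_group_add) hopf_data \<Rightarrow> nat
      \<Rightarrow> 'h \<Rightarrow> ('h list \<Rightarrow>\<^sub>0 'k) set" where
  "iter_comult A 0 x = tscale (hscale A) 0 (hcounit A x) (pure (hscale A) [])"
| "iter_comult A (Suc 0) x = pure (hscale A) [x]"
| "iter_comult A (Suc (Suc k)) x =
     tmap (hscale A) (Suc (Suc k))
       (\<lambda>hs. totimes (hscale A) (Suc (Suc k))
         (pure (hscale A) [hs ! 0]) (iter_comult A (Suc k) (hs ! 1)))
       (hcomult A x)"

text \<open>\<open>P\<^sub>\<alpha> = p\<^bsub>\<alpha>\<^sub>1\<^esub> \<otimes> \<dots> \<otimes> p\<^bsub>\<alpha>\<^sub>k\<^esub>\<close>, where \<open>k\<close> is the length of \<open>\<alpha>\<close>.\<close>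

definition tensor_proj ::
    "('k::{comm_ring,comm_monoid_mult}, 'h::ab_group_add) hopf_data \<Rightarrow> nat list
      \<Rightarrow> ('h list \<Rightarrow>\<^sub>0 'k) set \<Rightarrow> ('h list \<Rightarrow>\<^sub>0 'k) set" where
  "tensor_proj A \<alpha> =
     tmap (hscale A) (length \<alpha>) (\<lambda>hs. pure (hscale A) (map2 (proj A) \<alpha> hs))"

text \<open>
  The left action of the permutations \<open>\<sigma>\<close> of \<open>{..<k}\<close> (positions are counted from \<open>0\<close>) on the
  \<open>k\<close>-th tensor power: position \<open>i\<close> of \<open>permute_list f hs\<close> holds \<open>hs ! f i\<close>.
\<close>

definition tensor_perm ::
    "('k::{comm_ring,comm_monoid_mult}, 'h::ab_group_add) hopf_data \<Rightarrow> nat \<Rightarrow> (nat \<Rightarrow> nat)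
      \<Rightarrow> ('h list \<Rightarrow>\<^sub>0 'k) set \<Rightarrow> ('h list \<Rightarrow>\<^sub>0 'k) set" where
  "tensor_perm A k \<sigma> =
     tmap (hscale A) k (\<lambda>hs. pure (hscale A) (permute_list (inv \<sigma>) hs))"

definition p_endo ::
    "('k::{comm_ring,comm_monoid_mult}, 'h::ab_group_add) hopf_data \<Rightarrow> nat list \<Rightarrow> (nat \<Rightarrow> nat)
      \<Rightarrow> 'h \<Rightarrow> 'h" where
  "p_endo A \<alpha> \<sigma> =
     iter_mult A \<circ> tensor_proj A \<alpha> \<circ> tensor_perm A (length \<alpha>) (inv \<sigma>) \<circ> iter_comult A (length \<alpha>)"

end

theory Submission
  imports Defs "HOL-Library.Discrete_Functions" "HOL-Library.Nat_Bijection"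
begin

text \<open>
  Let \<open>H\<close> be the free algebra on the intervals \<open>[i, j]\<close>, \<open>i < j\<close>, of the natural numbers, with
  \<open>\<Delta>[i, j] = \<Sum>\<^bsub>i \<le> m \<le> j\<^esub> [i, m] \<otimes> [m, j]\<close>, where \<open>[i, i] = 1\<close>, and with \<open>[i, j]\<close> in degree
  \<open>\<lfloor>\<surd>j\<rfloor> - \<lfloor>\<surd>i\<rfloor>\<close>. Many intervals have degree \<open>0\<close>, so this grading is not connected; the
  length of intervals is nevertheless a connected grading, which gives the antipode.
  The iterated coproduct of \<open>[i, j]\<close> runs over the chains \<open>i = i\<^sub>0 \<le> \<dots> \<le> i\<^sub>k = j\<close>. For a strict
  chain of length \<open>k\<close> the product of its steps permuted by \<open>\<sigma>\<close> is a word with \<open>k\<close> letters, which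
  determines both the chain and \<open>\<sigma>\<close> and does not occur in \<open>p\<^bsub>\<beta>,\<tau>\<^esub>[i, j]\<close> when \<open>\<beta>\<close> is shorter. Since the
  integer square root is constant on arbitrarily long intervals, the degrees of the steps of a
  strict chain can be prescribed arbitrarily. Hence the coefficient of a longest
  \<open>p\<^bsub>\<alpha>,\<sigma>\<^esub>\<close> in a vanishing linear combination can be read off, and it is zero.
\<close>

section \<open>Linear maps between free modules\<close>

abbreviation fext :: "('x \<Rightarrow> 'y \<Rightarrow>\<^sub>0 'k) \<Rightarrow> ('x \<Rightarrow>\<^sub>0 'k) \<Rightarrow> 'y \<Rightarrow>\<^sub>0 'k::{comm_ring,comm_monoid_mult}"
  where "fext \<equiv> lin_ext fscale"

abbreviation bas :: "'x \<Rightarrow> 'x \<Rightarrow>\<^sub>0 'k::{comm_ring,comm_monoid_mult}"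
  where "bas x \<equiv> Poly_Mapping.single x 1"

definition flin :: "(('x \<Rightarrow>\<^sub>0 'k::{comm_ring,comm_monoid_mult}) \<Rightarrow> ('y \<Rightarrow>\<^sub>0 'k)) \<Rightarrow> bool" where
  "flin g \<longleftrightarrow> (\<forall>x y. g (x + y) = g x + g y) \<and> (\<forall>c x. g (fscale c x) = fscale c (g x))"

lemma lookup_fscale [simp]: "Poly_Mapping.lookup (fscale c u) x = c * Poly_Mapping.lookup u x"
  by (cases "Poly_Mapping.lookup u x = 0") (auto simp: fscale_def Poly_Mapping.map.rep_eq)

lemma fscale_zero [simp]: "fscale c 0 = 0" "fscale 0 u = 0"
  by (auto intro!: poly_mapping_eqI)

lemma fscale_one [simp]: "fscale 1 u = u"
  by (auto intro!: poly_mapping_eqI)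

lemma fscale_fscale [simp]: "fscale c (fscale d u) = fscale (c * d) u"
  by (auto intro!: poly_mapping_eqI simp: ac_simps)

lemma fscale_single: "fscale c (Poly_Mapping.single x d) = Poly_Mapping.single x (c * d)"
  by (auto intro!: poly_mapping_eqI simp: lookup_single when_def)

lemma fscale_add: "fscale c (u + v) = fscale c u + fscale c v"
  by (auto intro!: poly_mapping_eqI simp: lookup_add algebra_simps)

lemma fscale_left_add: "fscale (c + d) u = fscale c u + fscale d u"
  by (auto intro!: poly_mapping_eqI simp: lookup_add algebra_simps)

lemma fscale_diff: "fscale c (u - v) = fscale c u - fscale c v"
  by (auto intro!: poly_mapping_eqI simp: lookup_minus right_diff_distrib)

lemma fscale_uminus: "fscale c (- u) = - fscale c u" "fscale (- c) u = - fscale c u"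
  by (auto intro!: poly_mapping_eqI)

lemma fscale_sum: "fscale c (sum f A) = (\<Sum>a\<in>A. fscale c (f a))"
  by (induction A rule: infinite_finite_induct) (auto simp: fscale_add)

lemma lin_ext_superset:
  assumes "finite A" "Poly_Mapping.keys u \<subseteq> A"
  shows "fext f u = (\<Sum>x\<in>A. fscale (Poly_Mapping.lookup u x) (f x))"
  unfolding lin_ext_def using assms
  by (intro sum.mono_neutral_left) (auto simp: in_keys_iff)

lemma lookup_fext:
  "Poly_Mapping.lookup (fext f u) y
    = (\<Sum>x\<in>Poly_Mapping.keys u. Poly_Mapping.lookup u x * Poly_Mapping.lookup (f x) y)"
  by (simp add: lin_ext_def lookup_sum)

lemma sum_keys_delta:
  fixes u :: "'x \<Rightarrow>\<^sub>0 'k::{comm_ring,comm_monoid_mult}"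
  shows "(\<Sum>x\<in>Poly_Mapping.keys u. Poly_Mapping.lookup u x * (if x = w then c else 0))
    = Poly_Mapping.lookup u w * c"
  by (simp add: if_distrib[of "(*) _"] in_keys_iff cong: if_cong)

lemma flinI:
  assumes "\<And>x y. g (x + y) = g x + g y" "\<And>c x. g (fscale c x) = fscale c (g x)"
  shows "flin g"
  using assms by (auto simp: flin_def)

lemma flin_add: "flin g \<Longrightarrow> g (x + y) = g x + g y"
  and flin_fscale: "flin g \<Longrightarrow> g (fscale c x) = fscale c (g x)"
  by (auto simp: flin_def)

lemma flin_zero: "flin g \<Longrightarrow> g 0 = 0"
  using flin_fscale[of g 0 0] by simp

lemma flin_uminus: "flin g \<Longrightarrow> g (- x) = - g x"
  using flin_add[of g x "- x"] flin_zero[of g] by (simp add: eq_neg_iff_add_eq_0 add.commute)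

lemma flin_diff: "flin g \<Longrightarrow> g (x - y) = g x - g y"
  using flin_add[of g x "- y"] flin_uminus[of g y] by simp

lemma flin_sum: "flin g \<Longrightarrow> g (sum f A) = (\<Sum>a\<in>A. g (f a))"
  by (induction A rule: infinite_finite_induct) (auto simp: flin_add flin_zero)

lemma flin_fext [intro]: "flin (fext f)"
proof (rule flinI)
  fix x y :: "'a \<Rightarrow>\<^sub>0 'b"
  let ?A = "Poly_Mapping.keys x \<union> Poly_Mapping.keys y"
  have "finite ?A" "Poly_Mapping.keys (x + y) \<subseteq> ?A"
    using Poly_Mapping.keys_add[of x y] by auto
  then show "fext f (x + y) = fext f x + fext f y"
    by (simp add: lin_ext_superset[of ?A] lookup_add fscale_left_add sum.distrib)
next
  fix c and x :: "'a \<Rightarrow>\<^sub>0 'b"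
  let ?A = "Poly_Mapping.keys x"
  have "Poly_Mapping.keys (fscale c x) \<subseteq> ?A"
    by (auto simp: in_keys_iff)
  then show "fext f (fscale c x) = fscale c (fext f x)"
    by (simp add: lin_ext_superset[of ?A] fscale_sum)
qed

lemma fext_single [simp]: "fext f (Poly_Mapping.single x c) = fscale c (f x)"
  using lin_ext_superset[of "{x}" "Poly_Mapping.single x c" f]
  by (auto simp: in_keys_iff lookup_single when_def)

lemma fext_zero [simp]: "fext f 0 = 0"
  by (simp add: lin_ext_def)

lemma fext_bas: "fext bas u = u"
proof (rule poly_mapping_eqI)
  fix k
  show "Poly_Mapping.lookup (fext bas u) k = Poly_Mapping.lookup u k"
    by (auto simp: lin_ext_def lookup_sum lookup_single when_def in_keys_iff if_distrib
        cong: if_cong)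
qed

lemma flin_comp_fext: "flin g \<Longrightarrow> g (fext f u) = fext (\<lambda>x. g (f x)) u"
  by (simp add: lin_ext_def flin_sum flin_fscale)

lemma flin_eq_fext: "flin g \<Longrightarrow> g u = fext (\<lambda>x. g (bas x)) u"
  using flin_comp_fext[of g bas u] by (simp add: fext_bas)

lemma flin_eqI:
  assumes "flin f" "flin g" "\<And>x. f (bas x) = g (bas x)"
  shows "f u = g u"
  by (simp only: flin_eq_fext[OF assms(1), of u] flin_eq_fext[OF assms(2), of u] assms(3))

lemma flin_id [intro]: "flin (\<lambda>x. x)"
  by (rule flinI) auto

lemma flin_comp [intro]: "flin f \<Longrightarrow> flin (\<lambda>x. fext g (f x))"
  by (rule flinI) (auto simp: flin_add flin_fscale flin_fext)

lemma flin_compose: "flin g \<Longrightarrow> flin f \<Longrightarrow> flin (\<lambda>x. g (f x))"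
  by (rule flinI) (auto simp: flin_add flin_fscale)

lemma flin_fscale_pt: "flin f \<Longrightarrow> flin (\<lambda>x. fscale c (f x))"
  by (rule flinI) (auto simp: flin_add flin_fscale fscale_add ac_simps)

lemma flin_sum_pt: "(\<And>a. a \<in> A \<Longrightarrow> flin (f a)) \<Longrightarrow> flin (\<lambda>x. \<Sum>a\<in>A. f a x)"
  by (rule flinI) (auto simp: flin_add flin_fscale fscale_sum sum.distrib)

text \<open>Linearity in the function that is extended, not in \<open>u\<close>: for fixed
  \<open>u\<close> the extension is a finite sum over its keys.\<close>

lemma flin_fext_param [intro]:
  assumes "\<And>y. flin (\<lambda>x. F x y)"
  shows "flin (\<lambda>x. fext (F x) u)"
  unfolding lin_ext_def by (intro flin_sum_pt flin_fscale_pt assms)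

lemma fext_cong:
  "(\<And>x. x \<in> Poly_Mapping.keys u \<Longrightarrow> f x = g x) \<Longrightarrow> fext f u = fext g u"
  by (simp add: lin_ext_def)

section \<open>Submodules, spans and kernels\<close>

lemma is_submodule_sum:
  assumes "is_submodule s M" "\<And>a. a \<in> A \<Longrightarrow> f a \<in> M"
  shows "sum f A \<in> M"
  using assms(2)
  by (induction A rule: infinite_finite_induct) (use assms(1) in \<open>auto simp: is_submodule_def\<close>)

lemma is_submodule_fext:
  assumes "is_submodule fscale M" "\<And>x. x \<in> Poly_Mapping.keys u \<Longrightarrow> f x \<in> M"
  shows "fext f u \<in> M"
  unfolding lin_ext_def using assms
  by (intro is_submodule_sum) (auto simp: is_submodule_def)

lemma is_submodule_diff:
  assumes "is_submodule fscale M" "x \<in> M" "y \<in> M"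
  shows "x - y \<in> M"
proof -
  have "fscale (- 1) y \<in> M" using assms by (auto simp: is_submodule_def)
  then show ?thesis using assms by (auto simp: is_submodule_def fscale_uminus dest: bspec)
qed

text \<open>Conditions on the support, such as a fixed word length or degree, become memberships in
  submodules, which \<open>is_submodule_fext\<close> lets one check on the images of basis
  elements.\<close>

lemma is_submodule_keys:
  "is_submodule fscale {u :: 'x \<Rightarrow>\<^sub>0 'k::{comm_ring,comm_monoid_mult}. \<forall>x\<in>Poly_Mapping.keys u. P x}"
  unfolding is_submodule_def
proof (intro conjI ballI allI)
  fix x y :: "'x \<Rightarrow>\<^sub>0 'k::{comm_ring,comm_monoid_mult}"
  assume "x \<in> {u. \<forall>x\<in>Poly_Mapping.keys u. P x}" "y \<in> {u. \<forall>x\<in>Poly_Mapping.keys u. P x}"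
  then show "x + y \<in> {u. \<forall>x\<in>Poly_Mapping.keys u. P x}"
    using Poly_Mapping.keys_add[of x y] by auto
next
  fix c and x :: "'x \<Rightarrow>\<^sub>0 'k::{comm_ring,comm_monoid_mult}"
  assume "x \<in> {u. \<forall>x\<in>Poly_Mapping.keys u. P x}"
  then show "fscale c x \<in> {u. \<forall>x\<in>Poly_Mapping.keys u. P x}"
    by (auto simp: in_keys_iff)
qed auto

lemma is_submodule_lin_span: "is_submodule fscale (lin_span fscale B)"
  unfolding is_submodule_def
proof (intro conjI ballI allI)
  show "0 \<in> lin_span fscale B"
    unfolding lin_span_def by (auto intro!: exI[of _ "{}"])
next
  fix x y assume "x \<in> lin_span fscale B" "y \<in> lin_span fscale B"
  then obtain F c G d where F: "finite F" "F \<subseteq> B" "x = (\<Sum>b\<in>F. fscale (c b) b)"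
    and G: "finite G" "G \<subseteq> B" "y = (\<Sum>b\<in>G. fscale (d b) b)"
    unfolding lin_span_def by blast
  \<comment> \<open>Both combinations are extended by zero coefficients to the common index
    set.\<close>
  let ?e = "\<lambda>b. (if b \<in> F then c b else 0) + (if b \<in> G then d b else 0)"
  have "x = (\<Sum>b\<in>F \<union> G. fscale (if b \<in> F then c b else 0) b)"
    unfolding F(3) using F G by (intro sum.mono_neutral_cong_left) auto
  moreover have "y = (\<Sum>b\<in>F \<union> G. fscale (if b \<in> G then d b else 0) b)"
    unfolding G(3) using F G by (intro sum.mono_neutral_cong_left) auto
  ultimately have "x + y = (\<Sum>b\<in>F \<union> G. fscale (?e b) b)"
    by (simp add: sum.distrib fscale_left_add)
  then show "x + y \<in> lin_span fscale B"
    unfolding lin_span_def using F G by (intro CollectI exI[of _ "F \<union> G"] exI[of _ ?e]) auto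
next
  fix c' x assume "x \<in> lin_span fscale B"
  then obtain F c where F: "finite F" "F \<subseteq> B" "x = (\<Sum>b\<in>F. fscale (c b) b)"
    unfolding lin_span_def by blast
  then have "fscale c' x = (\<Sum>b\<in>F. fscale (c' * c b) b)"
    by (simp add: fscale_sum)
  then show "fscale c' x \<in> lin_span fscale B"
    unfolding lin_span_def using F(1,2)
    by (intro CollectI exI[of _ F] exI[of _ "\<lambda>b. c' * c b"]) auto
qed

lemma lin_span_superset: "b \<in> B \<Longrightarrow> b \<in> lin_span fscale B"
  unfolding lin_span_def by (auto intro!: exI[of _ "{b}"] exI[of _ "\<lambda>_. 1"])

lemma lin_span_least:
  assumes "is_submodule fscale M" "B \<subseteq> M"
  shows "lin_span fscale B \<subseteq> M"
  unfolding lin_span_def using assms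
  by (auto intro!: is_submodule_sum[OF assms(1)]) (auto simp: is_submodule_def)

lemma is_submodule_kernel: "flin g \<Longrightarrow> is_submodule fscale {u. g u = 0}"
  by (auto simp: is_submodule_def flin_add flin_fscale flin_zero)

section \<open>Coordinates on tensor powers of a free module\<close>

definition multilin ::
    "nat \<Rightarrow> (('x \<Rightarrow>\<^sub>0 'k::{comm_ring,comm_monoid_mult}) list \<Rightarrow> ('y \<Rightarrow>\<^sub>0 'k)) \<Rightarrow> bool" where
  "multilin n f \<longleftrightarrow> (\<forall>xs ys. length xs + 1 + length ys = n \<longrightarrow> flin (\<lambda>a. f (xs @ [a] @ ys)))"

text \<open>The coefficient at a word \<open>ws\<close> is the product of the coefficients of
  \<open>ws ! j\<close> in \<open>hs ! j\<close>, so this is the expansion of a pure tensor in the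
  basis of words.\<close>

fun coord1 :: "('x \<Rightarrow>\<^sub>0 'k::{comm_ring,comm_monoid_mult}) list \<Rightarrow> ('x list \<Rightarrow>\<^sub>0 'k)" where
  "coord1 [] = bas []"
| "coord1 (h # hs) = fext (\<lambda>w. fext (\<lambda>ws. bas (w # ws)) (coord1 hs)) h"

text \<open>The identification of a tensor power of a free module with the free module on words. It
  goes through the arbitrary representative \<open>trep X\<close>;
  \<open>coord_multilin_rels\<close> shows that the choice does not matter.\<close>

definition coord :: "(('x \<Rightarrow>\<^sub>0 'k::{comm_ring,comm_monoid_mult}) list \<Rightarrow>\<^sub>0 'k) set \<Rightarrow> ('x list \<Rightarrow>\<^sub>0 'k)"
  where "coord X = fext coord1 (trep X)"

section \<open>Multilinear maps and their values on basis words\<close>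

lemma multilinI:
  assumes "\<And>xs ys. length xs + 1 + length ys = n \<Longrightarrow> flin (\<lambda>a. f (xs @ [a] @ ys))"
  shows "multilin n f"
  using assms by (auto simp: multilin_def)

lemma multilinD: "multilin n f \<Longrightarrow> length xs + 1 + length ys = n \<Longrightarrow> flin (\<lambda>a. f (xs @ [a] @ ys))"
  unfolding multilin_def by blast

text \<open>List updates suit operations such as \<open>permute_list\<close> and
  \<open>map2\<close>, through which a splitting \<open>xs @ [a] @ ys\<close> would be awkward to
  follow.\<close>

lemma multilin_update:
  "multilin n f \<Longrightarrow> length hs = n \<Longrightarrow> i < n \<Longrightarrow> flin (\<lambda>a. f (hs[i := a]))"
  using multilinD[of n f "take i hs" "drop (Suc i) hs"] by (simp add: upd_conv_take_nth_drop)

lemma multilin_updateI: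
  assumes "\<And>hs i. length hs = n \<Longrightarrow> i < n \<Longrightarrow> flin (\<lambda>a. f (hs[i := a]))"
  shows "multilin n f"
proof (rule multilinI)
  fix xs ys :: "('a \<Rightarrow>\<^sub>0 'b) list"
  assume "length xs + 1 + length ys = n"
  then show "flin (\<lambda>a. f (xs @ [a] @ ys))"
    using assms[of "xs @ [0] @ ys" "length xs"] by simp
qed

lemma multilin_2:
  assumes "\<And>y. flin (\<lambda>x. f [x, y])" "\<And>x. flin (\<lambda>y. f [x, y])"
  shows "multilin 2 f"
proof (rule multilinI)
  fix xs ys :: "('a \<Rightarrow>\<^sub>0 'b) list"
  assume "length xs + 1 + length ys = 2"
  then consider x where "xs = [x]" "ys = []" | y where "xs = []" "ys = [y]"
    by (cases xs; cases ys) (auto simp: numeral_eq_Suc)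
  then show "flin (\<lambda>a. f (xs @ [a] @ ys))"
    using assms by cases auto
qed

lemma multilin_coord1: "multilin n coord1"
proof (rule multilinI)
  fix xs ys :: "('a \<Rightarrow>\<^sub>0 'b) list"
  show "flin (\<lambda>a. coord1 (xs @ [a] @ ys))"
    by (induction xs) auto
qed

lemma coord1_length: "ws \<in> Poly_Mapping.keys (coord1 hs) \<Longrightarrow> length ws = length hs"
proof -
  have "coord1 hs \<in> {u. \<forall>ws\<in>Poly_Mapping.keys u. length ws = length hs}"
  proof (induction hs)
    case (Cons h hs)
    then show ?case
      by (simp only: coord1.simps) (intro is_submodule_fext is_submodule_keys; auto split: if_splits)
  qed (auto split: if_splits)
  then show "ws \<in> Poly_Mapping.keys (coord1 hs) \<Longrightarrow> length ws = length hs" by auto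
qed

lemma coord1_bas: "coord1 (map bas ws) = bas ws"
  by (induction ws) auto

text \<open>
  Working modulo a submodule \<open>N\<close> covers both honest multilinear maps (\<open>N = 0\<close>) and the
  universal one, \<open>hs \<mapsto> bas hs\<close> modulo the relations of multilinearity.
\<close>

lemma multilin_expand_mod:
  assumes N: "is_submodule fscale N"
    and add: "\<And>xs ys a b. length xs + 1 + length ys = n \<Longrightarrow>
      f (xs @ [a + b] @ ys) - f (xs @ [a] @ ys) - f (xs @ [b] @ ys) \<in> N"
    and scale: "\<And>xs ys c a. length xs + 1 + length ys = n \<Longrightarrow>
      f (xs @ [fscale c a] @ ys) - fscale c (f (xs @ [a] @ ys)) \<in> N"
    and "length xs + length hs = n"
  shows "f (xs @ hs) - fext (\<lambda>ws. f (xs @ map bas ws)) (coord1 hs) \<in> N"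
  using assms(4)
proof (induction hs arbitrary: xs)
  case Nil
  then show ?case using N by (simp add: is_submodule_def)
next
  case (Cons h hs)
  have len: "length xs + 1 + length hs = n" using Cons.prems by simp
  have Nadd: "x + y \<in> N" if "x \<in> N" "y \<in> N" for x y
    using N that by (auto simp: is_submodule_def)
  \<comment> \<open>The homogeneity relation with scalar 0; it starts the induction that extends
    additivity to finite sums.\<close>
  have zero: "f (xs @ [0] @ hs) \<in> N"
    using scale[OF len, of 0 0] by simp
  have fin: "f (xs @ [sum g A] @ hs) - (\<Sum>a\<in>A. f (xs @ [g a] @ hs)) \<in> N" if "finite A"
    for g :: "_ \<Rightarrow> _ \<Rightarrow>\<^sub>0 _" and A using that
  proof (induction A rule: finite_induct)
    case empty
    then show ?case using zero by simp
  next
    case (insert a A)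
    then show ?case
      using Nadd[OF add[OF len, of "g a" "sum g A"] insert.IH] by (simp add: algebra_simps)
  qed
  have h: "h = (\<Sum>w\<in>Poly_Mapping.keys h. fscale (Poly_Mapping.lookup h w) (bas w))"
    using fext_bas[of h] by (simp add: lin_ext_def)
  \<comment> \<open>Three errors in \<open>N\<close> add up to the claim: splitting \<open>h\<close>
    into monomials, pulling out their scalars, and expanding the remaining entries with
    \<open>bas w\<close> moved into the prefix, which is why the induction varies
    \<open>xs\<close>.\<close>
  have 1: "f (xs @ [h] @ hs)
      - (\<Sum>w\<in>Poly_Mapping.keys h. f (xs @ [fscale (Poly_Mapping.lookup h w) (bas w)] @ hs)) \<in> N"
    using fin[of "Poly_Mapping.keys h" "\<lambda>w. fscale (Poly_Mapping.lookup h w) (bas w)"] h by simp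
  have 2: "(\<Sum>w\<in>Poly_Mapping.keys h. f (xs @ [fscale (Poly_Mapping.lookup h w) (bas w)] @ hs)
      - fscale (Poly_Mapping.lookup h w) (f (xs @ [bas w] @ hs))) \<in> N"
    by (intro is_submodule_sum[OF N] scale len)
  have 3: "fext (\<lambda>w. f ((xs @ [bas w]) @ hs)
      - fext (\<lambda>ws. f ((xs @ [bas w]) @ map bas ws)) (coord1 hs)) h \<in> N"
    using Cons.prems by (intro is_submodule_fext[OF N] Cons.IH) simp
  have eq: "fext (\<lambda>ws. f (xs @ map bas ws)) (coord1 (h # hs))
      = fext (\<lambda>w. fext (\<lambda>ws. f ((xs @ [bas w]) @ map bas ws)) (coord1 hs)) h"
    by (simp add: flin_comp_fext[OF flin_fext])
  show ?case unfolding eq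
    using Nadd[OF Nadd[OF 1 2] 3]
    by (simp add: lin_ext_def sum_subtractf fscale_diff fscale_sum)
qed

lemma multilin_expand:
  assumes "multilin n f" "length hs = n"
  shows "f hs = fext (\<lambda>ws. f (map bas ws)) (coord1 hs)"
proof -
  have "f ([] @ hs) - fext (\<lambda>ws. f ([] @ map bas ws)) (coord1 hs) \<in> {0}"
  proof (rule multilin_expand_mod[of "{0}" n])
    fix xs ys :: "('a \<Rightarrow>\<^sub>0 'b) list" and a b c
    assume len: "length xs + 1 + length ys = n"
    note l = multilinD[OF assms(1) len]
    show "f (xs @ [a + b] @ ys) - f (xs @ [a] @ ys) - f (xs @ [b] @ ys) \<in> {0}"
      using flin_add[OF l, of a b] by simp
    show "f (xs @ [fscale c a] @ ys) - fscale c (f (xs @ [a] @ ys)) \<in> {0}"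
      using flin_fscale[OF l, of c a] by simp
  qed (use assms in \<open>auto simp: is_submodule_def\<close>)
  then show ?thesis by simp
qed

section \<open>Equality of tensors as equality of coordinates\<close>

lemma is_submodule_word_sums: "is_submodule fscale (word_sums n)"
  unfolding word_sums_def by (rule is_submodule_keys)

lemma single_in_word_sums: "length hs = n \<Longrightarrow> Poly_Mapping.single hs c \<in> word_sums n"
  by (auto simp: word_sums_def split: if_splits)

lemma is_submodule_multilin_rels: "is_submodule fscale (multilin_rels s n)"
  unfolding multilin_rels_def by (rule is_submodule_lin_span)

text \<open>Since \<open>coord1\<close> is multilinear, the generators of the relations lie in the
  kernel of its linear extension, hence so does their span.\<close>

lemma coord_multilin_rels:
  fixes u :: "('x \<Rightarrow>\<^sub>0 'k::{comm_ring,comm_monoid_mult}) list \<Rightarrow>\<^sub>0 'k"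
  assumes "u \<in> multilin_rels fscale n"
  shows "fext coord1 u = 0"
proof -
  have lin: "flin (\<lambda>a. coord1 (xs @ [a] @ ys))" for xs ys :: "('x \<Rightarrow>\<^sub>0 'k) list"
    by (rule multilinD[OF multilin_coord1 refl])
  have "multilin_rels fscale n \<subseteq> {u :: ('x \<Rightarrow>\<^sub>0 'k) list \<Rightarrow>\<^sub>0 'k. fext coord1 u = 0}"
    unfolding multilin_rels_def
    by (rule lin_span_least[OF is_submodule_kernel[OF flin_fext]])
      (auto simp: flin_diff[OF flin_fext] flin_add[OF lin, simplified]
        flin_fscale[OF lin, simplified])
  then show ?thesis using assms by auto
qed

text \<open>The map sending \<open>hs\<close> to \<open>bas hs\<close> is multilinear modulo the
  relations, so \<open>u\<close> can be rebuilt from its coordinates up to a relation. This is the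
  half that makes coordinates injective.\<close>

lemma word_sums_expand:
  assumes "u \<in> word_sums n"
  shows "u - fext (\<lambda>ws. bas (map bas ws)) (fext coord1 u) \<in> multilin_rels fscale n"
proof -
  let ?N = "multilin_rels fscale n :: (('a \<Rightarrow>\<^sub>0 'b) list \<Rightarrow>\<^sub>0 'b) set"
  have "bas ([] @ hs) - fext (\<lambda>ws. bas ([] @ map bas ws)) (coord1 hs) \<in> ?N" if "length hs = n"
    for hs :: "('a \<Rightarrow>\<^sub>0 'b) list"
  proof (rule multilin_expand_mod[OF is_submodule_multilin_rels])
    fix xs ys :: "('a \<Rightarrow>\<^sub>0 'b) list" and a b c
    assume len: "length xs + 1 + length ys = n"
    show "bas (xs @ [a + b] @ ys) - bas (xs @ [a] @ ys) - bas (xs @ [b] @ ys) \<in> ?N"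
      unfolding multilin_rels_def using len by (intro lin_span_superset) blast
    have "bas (xs @ [fscale c a] @ ys) - Poly_Mapping.single (xs @ [a] @ ys) c \<in> ?N"
      unfolding multilin_rels_def using len by (intro lin_span_superset) blast
    then show "bas (xs @ [fscale c a] @ ys) - fscale c (bas (xs @ [a] @ ys)) \<in> ?N"
      by (simp add: fscale_single)
  qed (use that in simp)
  then have "fext (\<lambda>hs. bas hs - fext (\<lambda>ws. bas (map bas ws)) (coord1 hs)) u \<in> ?N"
    using assms by (intro is_submodule_fext[OF is_submodule_multilin_rels]) (auto simp: word_sums_def)
  moreover have "fext (\<lambda>hs. bas hs - fext (\<lambda>ws. bas (map bas ws)) (coord1 hs)) u
      = fext bas u - fext (\<lambda>ws. bas (map bas ws)) (fext coord1 u)"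
    unfolding flin_comp_fext[OF flin_fext, of _ coord1 u]
    by (simp add: lin_ext_def sum_subtractf fscale_diff)
  ultimately show ?thesis by (simp add: fext_bas)
qed

lemma multilin_rels_iff:
  assumes "u \<in> word_sums n" "v \<in> word_sums n"
  shows "u - v \<in> multilin_rels fscale n \<longleftrightarrow> fext coord1 u = fext coord1 v"
proof
  assume "u - v \<in> multilin_rels fscale n"
  then show "fext coord1 u = fext coord1 v"
    using coord_multilin_rels flin_diff[OF flin_fext, of coord1 u v] by fastforce
next
  assume "fext coord1 u = fext coord1 v"
  then show "u - v \<in> multilin_rels fscale n"
    using is_submodule_diff[OF is_submodule_multilin_rels word_sums_expand[OF assms(1)]
        word_sums_expand[OF assms(2)]]
    by (simp add: algebra_simps)
qed

lemma tensor_eq_iff: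
  "(u, v) \<in> tensor_eq fscale n
    \<longleftrightarrow> u \<in> word_sums n \<and> v \<in> word_sums n \<and> fext coord1 u = fext coord1 v"
  using multilin_rels_iff by (auto simp: tensor_eq_def)

text \<open>The chosen representative may differ from \<open>u\<close>, but only by relations, and
  these have coordinates zero.\<close>

lemma trep_tclass:
  assumes "u \<in> word_sums n"
  shows "trep (tclass fscale n u) \<in> word_sums n" "coord (tclass fscale n u) = fext coord1 u"
proof -
  have "u \<in> tclass fscale n u"
    using assms by (simp add: tclass_def tensor_eq_iff)
  then have "trep (tclass fscale n u) \<in> tclass fscale n u"
    unfolding trep_def by (rule someI)
  then have "(u, trep (tclass fscale n u)) \<in> tensor_eq fscale n"
    by (simp add: tclass_def)
  then show "trep (tclass fscale n u) \<in> word_sums n" "coord (tclass fscale n u) = fext coord1 u"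
    by (auto simp: tensor_eq_iff coord_def)
qed

lemma tclass_in: "u \<in> word_sums n \<Longrightarrow> tclass fscale n u \<in> tensor_power fscale n"
  unfolding tclass_def tensor_power_def by (rule quotientI)

lemma tensor_powerE:
  assumes "X \<in> tensor_power fscale n"
  obtains u where "u \<in> word_sums n" "X = tclass fscale n u"
  using assms unfolding tensor_power_def tclass_def by (auto elim: quotientE)

lemma trep_in_word_sums: "X \<in> tensor_power fscale n \<Longrightarrow> trep X \<in> word_sums n"
  by (auto elim!: tensor_powerE intro: trep_tclass)

text \<open>The identities between cosets required of the coproduct are all proved through this
  reduction to a free module on words.\<close>

lemma coord_inject:
  assumes "X \<in> tensor_power fscale n" "Y \<in> tensor_power fscale n" "coord X = coord Y"
  shows "X = Y"
proof -
  obtain u v where u: "u \<in> word_sums n" "X = tclass fscale n u"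
    and v: "v \<in> word_sums n" "Y = tclass fscale n v"
    using assms(1,2) by (meson tensor_powerE)
  then have "fext coord1 u = fext coord1 v"
    using assms(3) by (simp add: trep_tclass)
  then show ?thesis unfolding u v
    using u(1) v(1) by (auto simp: tclass_def tensor_eq_iff)
qed

lemma coord_length:
  assumes "X \<in> tensor_power fscale n" "ws \<in> Poly_Mapping.keys (coord X)"
  shows "length ws = n"
proof -
  have "coord X \<in> {u. \<forall>ws\<in>Poly_Mapping.keys u. length ws = n}"
    unfolding coord_def using trep_in_word_sums[OF assms(1)]
    by (intro is_submodule_fext is_submodule_keys) (auto simp: word_sums_def dest: coord1_length)
  then show ?thesis using assms(2) by auto
qed

text \<open>Evaluating a multilinear map on a representative depends only on the coordinates, so the
  arbitrary choice in \<open>teval\<close> and \<open>tmap\<close> is harmless.\<close>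

lemma fext_trep:
  assumes "X \<in> tensor_power fscale m" "multilin m f"
  shows "fext f (trep X) = fext (\<lambda>ws. f (map bas ws)) (coord X)"
proof -
  have "fext f (trep X) = fext (\<lambda>hs. fext (\<lambda>ws. f (map bas ws)) (coord1 hs)) (trep X)"
    using trep_in_word_sums[OF assms(1)] multilin_expand[OF assms(2)]
    by (intro fext_cong) (auto simp: word_sums_def)
  then show ?thesis by (simp add: coord_def flin_comp_fext[OF flin_fext])
qed

lemma teval_coord:
  assumes "X \<in> tensor_power fscale m" "multilin m f"
  shows "teval fscale f X = fext (\<lambda>ws. f (map bas ws)) (coord X)"
  unfolding teval_def by (rule fext_trep[OF assms])

section \<open>Tensor operations in coordinates\<close>

lemma pure_in: "pure fscale hs \<in> tensor_power fscale (length hs)"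
  unfolding pure_def by (intro tclass_in single_in_word_sums refl)

lemma pure_in_length: "length hs = n \<Longrightarrow> pure fscale hs \<in> tensor_power fscale n"
  using pure_in by blast

lemma coord_pure: "coord (pure fscale hs) = coord1 hs"
  by (simp add: pure_def trep_tclass single_in_word_sums)

text \<open>The map \<open>G\<close> takes values in cosets, to which \<open>multilin\<close> does
  not apply, so multilinearity is stated for its coordinates. Only the values of \<open>G\<close> on
  words of the right length are constrained.\<close>

lemma
  assumes "X \<in> tensor_power fscale m"
    and G: "\<And>hs. length hs = m \<Longrightarrow> G hs \<in> tensor_power fscale n"
  shows tmap_in: "tmap fscale n G X \<in> tensor_power fscale n"
    and coord_tmap: "multilin m (\<lambda>hs. coord (G hs)) \<Longrightarrow>
      coord (tmap fscale n G X) = fext (\<lambda>ws. coord (G (map bas ws))) (coord X)"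
proof -
  have *: "fext (\<lambda>hs. trep (G hs)) (trep X) \<in> word_sums n"
    using trep_in_word_sums[OF assms(1)] G
    by (intro is_submodule_fext is_submodule_word_sums trep_in_word_sums) (auto simp: word_sums_def)
  show "tmap fscale n G X \<in> tensor_power fscale n"
    unfolding tmap_def by (rule tclass_in[OF *])
  assume "multilin m (\<lambda>hs. coord (G hs))"
  then have "fext (\<lambda>hs. coord (G hs)) (trep X) = fext (\<lambda>ws. coord (G (map bas ws))) (coord X)"
    by (rule fext_trep[OF assms(1)])
  then show "coord (tmap fscale n G X) = fext (\<lambda>ws. coord (G (map bas ws))) (coord X)"
    unfolding tmap_def trep_tclass(2)[OF *] flin_comp_fext[OF flin_fext, of _ "\<lambda>hs. trep (G hs)"]
    by (simp only: coord_def[of "G _"])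
qed

lemma
  assumes "X \<in> tensor_power fscale n" "Y \<in> tensor_power fscale n"
  shows tadd_in: "tadd fscale n X Y \<in> tensor_power fscale n"
    and coord_tadd: "coord (tadd fscale n X Y) = coord X + coord Y"
proof -
  have *: "trep X + trep Y \<in> word_sums n"
    using assms[THEN trep_in_word_sums] is_submodule_word_sums[of n] unfolding is_submodule_def by blast
  show "tadd fscale n X Y \<in> tensor_power fscale n"
    unfolding tadd_def by (rule tclass_in[OF *])
  show "coord (tadd fscale n X Y) = coord X + coord Y"
    unfolding tadd_def trep_tclass(2)[OF *] flin_add[OF flin_fext] coord_def[of X] coord_def[of Y] ..
qed

lemma
  assumes "X \<in> tensor_power fscale n"
  shows tscale_in: "tscale fscale n c X \<in> tensor_power fscale n"
    and coord_tscale: "coord (tscale fscale n c X) = fscale c (coord X)"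
proof -
  have *: "fscale c (trep X) \<in> word_sums n"
    using assms[THEN trep_in_word_sums] is_submodule_word_sums[of n] unfolding is_submodule_def by blast
  show "tscale fscale n c X \<in> tensor_power fscale n"
    unfolding tscale_def by (rule tclass_in[OF *])
  show "coord (tscale fscale n c X) = fscale c (coord X)"
    unfolding tscale_def trep_tclass(2)[OF *] flin_fscale[OF flin_fext] coord_def[of X] ..
qed

lemma multilin_append:
  fixes f :: "('a \<Rightarrow>\<^sub>0 'b::{comm_ring,comm_monoid_mult}) list \<Rightarrow> ('c \<Rightarrow>\<^sub>0 'b)"
  assumes "multilin n f"
  shows "length xs + m = n \<Longrightarrow> multilin m (\<lambda>ys. f (xs @ ys))"
    and "m + length ys = n \<Longrightarrow> multilin m (\<lambda>xs. f (xs @ ys))"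
proof -
  assume len: "length xs + m = n"
  show "multilin m (\<lambda>ys. f (xs @ ys))"
  proof (rule multilinI)
    fix as bs :: "('a \<Rightarrow>\<^sub>0 'b) list" assume "length as + 1 + length bs = m"
    then show "flin (\<lambda>a. f (xs @ as @ [a] @ bs))"
      using multilinD[OF assms, of "xs @ as" bs] len by simp
  qed
next
  assume len: "m + length ys = n"
  show "multilin m (\<lambda>xs. f (xs @ ys))"
  proof (rule multilinI)
    fix as bs :: "('a \<Rightarrow>\<^sub>0 'b) list" assume "length as + 1 + length bs = m"
    then show "flin (\<lambda>a. f ((as @ [a] @ bs) @ ys))"
      using multilinD[OF assms, of as "bs @ ys"] len by simp
  qed
qed

lemma multilin_cong:
  assumes "multilin n f" "\<And>hs. length hs = n \<Longrightarrow> g hs = f hs"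
  shows "multilin n g"
proof (rule multilinI)
  fix xs ys :: "('a \<Rightarrow>\<^sub>0 'b) list"
  assume len: "length xs + 1 + length ys = n"
  then have "(\<lambda>a. g (xs @ [a] @ ys)) = (\<lambda>a. f (xs @ [a] @ ys))"
    by (intro ext assms(2)) simp
  then show "flin (\<lambda>a. g (xs @ [a] @ ys))"
    using multilinD[OF assms(1) len] by simp
qed

lemma multilin_fext_param:
  "(\<And>y. y \<in> Poly_Mapping.keys u \<Longrightarrow> multilin m (\<lambda>xs. F xs y)) \<Longrightarrow> multilin m (\<lambda>xs. fext (F xs) u)"
  unfolding multilin_def lin_ext_def by (auto intro!: flin_sum_pt flin_fscale_pt)

lemma
  assumes X: "X \<in> tensor_power fscale a" and Y: "Y \<in> tensor_power fscale b" and n: "n = a + b"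
  shows totimes_in: "totimes fscale n X Y \<in> tensor_power fscale n"
    and coord_totimes: "coord (totimes fscale n X Y)
      = fext (\<lambda>us. fext (\<lambda>vs. bas (us @ vs)) (coord Y)) (coord X)"
proof -
  have pin: "pure fscale (xs @ ys) \<in> tensor_power fscale n" if "length xs = a" "length ys = b"
    for xs ys :: "('a \<Rightarrow>\<^sub>0 'b) list"
    using pure_in[of "xs @ ys"] n that by simp
  have inner_in: "tmap fscale n (\<lambda>ys. pure fscale (xs @ ys)) Y \<in> tensor_power fscale n"
    and inner_coord: "coord (tmap fscale n (\<lambda>ys. pure fscale (xs @ ys)) Y)
      = fext (\<lambda>vs. coord1 (xs @ map bas vs)) (coord Y)"
    if "length xs = a" for xs :: "('a \<Rightarrow>\<^sub>0 'b) list"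
  proof -
    show "tmap fscale n (\<lambda>ys. pure fscale (xs @ ys)) Y \<in> tensor_power fscale n"
      using Y pin[OF that] by (rule tmap_in)
    have "multilin b (\<lambda>hs. coord1 (xs @ hs))"
      using multilin_append(1)[OF multilin_coord1[of n], of xs b] that n by simp
    then show "coord (tmap fscale n (\<lambda>ys. pure fscale (xs @ ys)) Y)
      = fext (\<lambda>vs. coord1 (xs @ map bas vs)) (coord Y)"
      using coord_tmap[OF Y pin[OF that]] by (simp add: coord_pure)
  qed
  show "totimes fscale n X Y \<in> tensor_power fscale n"
    unfolding totimes_def using X inner_in by (rule tmap_in)
  \<comment> \<open>Linearity in the left factor becomes visible only after the inner map has been
    computed in coordinates.\<close>
  have "multilin a (\<lambda>xs. fext (\<lambda>vs. coord1 (xs @ map bas vs)) (coord Y))"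
    by (intro multilin_fext_param multilin_append(2)[OF multilin_coord1[of n]])
      (simp add: coord_length[OF Y] n)
  then have "multilin a (\<lambda>xs. coord (tmap fscale n (\<lambda>ys. pure fscale (xs @ ys)) Y))"
    by (rule multilin_cong) (rule inner_coord)
  from coord_tmap[OF X inner_in this]
  have "coord (totimes fscale n X Y) =
    fext (\<lambda>ws. coord (tmap fscale n (\<lambda>ys. pure fscale (map bas ws @ ys)) Y)) (coord X)"
    unfolding totimes_def by simp
  also have "\<dots> = fext (\<lambda>us. fext (\<lambda>vs. bas (us @ vs)) (coord Y)) (coord X)"
  proof (rule fext_cong)
    fix ws assume "ws \<in> Poly_Mapping.keys (coord X)"
    then have "length (map bas ws :: ('a \<Rightarrow>\<^sub>0 'b) list) = a" using coord_length[OF X] by simp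
    from inner_coord[OF this]
    show "coord (tmap fscale n (\<lambda>ys. pure fscale (map bas ws @ ys)) Y)
        = fext (\<lambda>vs. bas (ws @ vs)) (coord Y)"
      by (simp only: map_append[symmetric] coord1_bas)
  qed
  finally show "coord (totimes fscale n X Y)
      = fext (\<lambda>us. fext (\<lambda>vs. bas (us @ vs)) (coord Y)) (coord X)" .
qed

section \<open>The free algebra on the intervals of the natural numbers\<close>

text \<open>
  The letter \<open>prod_encode (i, l)\<close> stands for the interval from \<open>i\<close> to \<open>i + l + 1\<close>; thus
  \<open>gen i l\<close> is the interval of length \<open>l\<close> starting at \<open>i\<close>, where intervals of length \<open>0\<close> are
  identified with the empty word.
\<close>

definition gen :: "nat \<Rightarrow> nat \<Rightarrow> nat list" where
  "gen i l = (case l of 0 \<Rightarrow> [] | Suc l' \<Rightarrow> [prod_encode (i, l')])"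

definition letter_deg :: "nat \<Rightarrow> nat" where
  "letter_deg n = (case prod_decode n of (i, l) \<Rightarrow> floor_sqrt (i + Suc l) - floor_sqrt i)"

definition deg :: "nat list \<Rightarrow> nat" where
  "deg w = sum_list (map letter_deg w)"

text \<open>
  \<open>csum w f\<close> is the sum of \<open>f u v\<close> over the terms \<open>u \<otimes> v\<close> of the coproduct of the word \<open>w\<close>:
  each interval of \<open>w\<close> is cut at one of its points, endpoints included.
\<close>

primrec csum :: "nat list \<Rightarrow> (nat list \<Rightarrow> nat list \<Rightarrow> 'm) \<Rightarrow> 'm::comm_monoid_add" where
  "csum [] f = f [] []"
| "csum (n # w) f = (case prod_decode n of (i, l) \<Rightarrow>
     \<Sum>m\<le>Suc l. csum w (\<lambda>u v. f (gen i m @ u) (gen (i + m) (Suc l - m) @ v)))"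

declare sum.atMost_Suc [simp del]

lemma gen_0 [simp]: "gen i 0 = []"
  by (simp add: gen_def)

lemma gen_Suc: "gen i (Suc l) = [prod_encode (i, l)]"
  by (simp add: gen_def)

text \<open>Every letter is an interval because the pairing is surjective, so later inductions
  handle intervals without decoding letters.\<close>

lemma word_induct [case_names Nil gen]:
  assumes "P []" "\<And>i l w. P w \<Longrightarrow> P (gen i (Suc l) @ w)"
  shows "P w"
proof (induction w)
  case (Cons n w)
  then show ?case
    using assms(2)[OF Cons, of "fst (prod_decode n)" "snd (prod_decode n)"] by (simp add: gen_Suc)
qed (rule assms(1))

lemma deg_Nil [simp]: "deg [] = 0"
  and deg_append [simp]: "deg (u @ v) = deg u + deg v"
  by (simp_all add: deg_def)

lemma deg_gen: "deg (gen i l) = floor_sqrt (i + l) - floor_sqrt i"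
  by (cases l) (auto simp: gen_def deg_def letter_deg_def)

text \<open>The differences of square roots telescope; monotonicity makes this correct for truncated
  subtraction.\<close>

lemma deg_gen_split: "m \<le> l \<Longrightarrow> deg (gen i m) + deg (gen (i + m) (l - m)) = deg (gen i l)"
  using mono_floor_sqrt'[of i "i + m"] mono_floor_sqrt'[of "i + m" "i + l"]
  by (simp add: deg_gen)

section \<open>Sums over the cuts of a word\<close>

lemma deg_cut:
  assumes "m \<le> l" "deg u + deg v = deg w"
  shows "deg (gen i m @ u) + deg (gen (i + m) (l - m) @ v) = deg (gen i l @ w)"
  using deg_gen_split[OF assms(1), of i] assms(2) by simp

text \<open>Identifying the interval of length 0 with the empty word makes the formula hold for
  \<open>l = 0\<close> too, with the single cut \<open>m = 0\<close>.\<close>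

lemma csum_gen_append:
  "csum (gen i l @ w) f = (\<Sum>m\<le>l. csum w (\<lambda>u v. f (gen i m @ u) (gen (i + m) (l - m) @ v)))"
  by (cases l) (simp_all add: gen_Suc)

lemma csum_gen: "csum (gen i l) f = (\<Sum>m\<le>l. f (gen i m) (gen (i + m) (l - m)))"
  using csum_gen_append[of i l "[]" f] by simp

lemma csum_cong:
  "(\<And>u v. deg u + deg v = deg w \<Longrightarrow> f u v = g u v) \<Longrightarrow> csum w f = csum w g"
proof (induction w arbitrary: f g rule: word_induct)
  case (gen i l w)
  show ?case
    unfolding csum_gen_append
    by (intro sum.cong refl gen.IH gen.prems deg_cut) auto
qed simp

lemma csum_0 [simp]: "csum w (\<lambda>u v. 0) = 0"
  by (induction w rule: word_induct) (auto simp: csum_gen_append)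

lemma csum_hom:
  assumes "g 0 = 0" "\<And>x y. g (x + y) = g x + g y"
  shows "g (csum w f) = csum w (\<lambda>u v. g (f u v))"
proof (induction w arbitrary: f rule: word_induct)
  case (gen i l w)
  have "g (sum h A) = (\<Sum>a\<in>A. g (h a))" for h :: "nat \<Rightarrow> _" and A
    by (induction A rule: infinite_finite_induct) (auto simp: assms)
  then show ?case by (simp add: csum_gen_append gen.IH)
qed simp

lemma flin_csum: "flin g \<Longrightarrow> g (csum w f) = csum w (\<lambda>u v. g (f u v))"
  by (rule csum_hom) (auto simp: flin_zero flin_add)

lemma csum_add: "csum w (\<lambda>u v. f u v + g u v) = csum w f + csum w g"
  by (induction w arbitrary: f g rule: word_induct) (auto simp: csum_gen_append sum.distrib)

lemma csum_sum: "csum w (\<lambda>u v. \<Sum>a\<in>A. f a u v) = (\<Sum>a\<in>A. csum w (f a))"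
  by (induction A rule: infinite_finite_induct) (auto simp: csum_add)

text \<open>On words this is the multiplicativity of the coproduct.\<close>

lemma csum_append:
  "csum (x @ y) f = csum x (\<lambda>a b. csum y (\<lambda>c d. f (a @ c) (b @ d)))"
  by (induction x arbitrary: f rule: word_induct) (auto simp: csum_gen_append)

text \<open>The degree condition available in the premise is what later gives the gradedness of the
  coproduct.\<close>

lemma csum_in_submodule:
  assumes "is_submodule s M" "\<And>u v. deg u + deg v = deg w \<Longrightarrow> f u v \<in> M"
  shows "csum w f \<in> M"
  using assms(2)
proof (induction w arbitrary: f rule: word_induct)
  case (gen i l w)
  show ?case
    unfolding csum_gen_append
    by (intro is_submodule_sum[OF assms(1)] gen.IH gen.prems deg_cut) auto
qed simp

text \<open>Cutting an interval of length \<open>l\<close> twice, with the left or the right piece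
  cut second, yields the triples of lengths with sum \<open>l\<close>; the arguments of
  \<open>F\<close> are these lengths. The reindexing serves coassociativity and the antipode
  alike.\<close>

lemma sum_interval_coassoc:
  fixes F :: "nat \<Rightarrow> nat \<Rightarrow> nat \<Rightarrow> 'm::comm_monoid_add"
  shows "(\<Sum>m\<le>l. \<Sum>a\<le>m. F a (m - a) (l - m)) = (\<Sum>a\<le>l. \<Sum>b\<le>l - a. F a b (l - a - b))"
proof -
  have "(\<Sum>m\<le>l. \<Sum>a\<le>m. F a (m - a) (l - m))
      = (\<Sum>(m, a)\<in>(SIGMA m:{..l}. {..m}). F a (m - a) (l - m))"
    by (simp add: sum.Sigma)
  also have "\<dots> = (\<Sum>(a, b)\<in>(SIGMA a:{..l}. {..l - a}). F a b (l - a - b))"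
    by (rule sum.reindex_bij_witness[of _ "\<lambda>(a, b). (a + b, a)" "\<lambda>(m, a). (a, m - a)"]) auto
  finally show ?thesis by (simp add: sum.Sigma)
qed

lemma csum_coassoc:
  "csum w (\<lambda>u v. csum u (\<lambda>a b. f a b v)) = csum w (\<lambda>u v. csum v (\<lambda>b c. f u b c))"
proof (induction w arbitrary: f rule: word_induct)
  case (gen i l w)
  \<comment> \<open>The terms in which the first interval is cut into pieces of lengths
    \<open>a\<close>, \<open>b\<close>, \<open>c\<close>; the rest of the word is left to the
    induction hypothesis.\<close>
  let ?F = "\<lambda>a b c. csum w (\<lambda>u v. csum u (\<lambda>x y.
    f (gen i a @ x) (gen (i + a) b @ y) (gen (i + a + b) c @ v)))"
  have "csum (gen i (Suc l) @ w) (\<lambda>u v. csum u (\<lambda>a b. f a b v))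
      = (\<Sum>m\<le>Suc l. \<Sum>a\<le>m. ?F a (m - a) (Suc l - m))"
    unfolding csum_gen_append csum_sum by (intro sum.cong refl) simp
  also have "\<dots> = (\<Sum>a\<le>Suc l. \<Sum>b\<le>Suc l - a. ?F a b (Suc l - a - b))"
    by (rule sum_interval_coassoc)
  also have "\<dots> = csum (gen i (Suc l) @ w) (\<lambda>u v. csum v (\<lambda>b c. f u b c))"
    unfolding csum_gen_append csum_sum gen.IH ..
  finally show ?case .
qed simp

lemma gen_neq_Nil: "l \<noteq> 0 \<Longrightarrow> gen i l \<noteq> []"
  by (cases l) (auto simp: gen_def)

text \<open>The left factor is empty only if every interval is cut at its left endpoint.\<close>

lemma csum_counit_left: "csum w (\<lambda>u v. if u = [] then f v else 0) = f w"
proof (induction w arbitrary: f rule: word_induct)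
  case (gen i l w)
  have "csum (gen i (Suc l) @ w) (\<lambda>u v. if u = [] then f v else 0)
      = (\<Sum>m\<le>Suc l. if m = 0 then f (gen i (Suc l) @ w) else 0)"
    unfolding csum_gen_append
  proof (rule sum.cong[OF refl])
    fix m
    show "csum w (\<lambda>u v. if gen i m @ u = [] then f (gen (i + m) (Suc l - m) @ v) else 0)
        = (if m = 0 then f (gen i (Suc l) @ w) else 0)"
      using gen[of "\<lambda>v. f (gen (i + m) (Suc l - m) @ v)"]
      by (cases "m = 0") (simp_all add: gen_neq_Nil)
  qed
  then show ?case by simp
qed simp

lemma csum_counit_right: "csum w (\<lambda>u v. if v = [] then f u else 0) = f w"
proof (induction w arbitrary: f rule: word_induct)
  case (gen i l w)
  have "csum (gen i (Suc l) @ w) (\<lambda>u v. if v = [] then f u else 0)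
      = (\<Sum>m\<le>Suc l. if m = Suc l then f (gen i (Suc l) @ w) else 0)"
    unfolding csum_gen_append
  proof (rule sum.cong[OF refl])
    fix m assume "m \<in> {..Suc l}"
    then show "csum w (\<lambda>u v. if gen (i + m) (Suc l - m) @ v = [] then f (gen i m @ u) else 0)
        = (if m = Suc l then f (gen i (Suc l) @ w) else 0)"
      using gen[of "\<lambda>u. f (gen i m @ u)"]
      by (cases "m = Suc l") (simp_all add: gen_neq_Nil)
  qed
  then show ?case by simp
qed simp

section \<open>Product, coproduct and antipode on words\<close>

definition word_mult ::
    "(nat list \<Rightarrow>\<^sub>0 'k::{comm_ring,comm_monoid_mult}) \<Rightarrow> (nat list \<Rightarrow>\<^sub>0 'k) \<Rightarrow> (nat list \<Rightarrow>\<^sub>0 'k)" where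
  "word_mult x y = fext (\<lambda>v. fext (\<lambda>w. bas (v @ w)) y) x"

lemma flin_word_mult_left: "flin f \<Longrightarrow> flin (\<lambda>x. word_mult (f x) y)"
  and flin_word_mult_right: "flin f \<Longrightarrow> flin (\<lambda>x. word_mult y (f x))"
  unfolding word_mult_def by auto

lemma word_mult_bas [simp]: "word_mult (bas v) (bas w) = bas (v @ w)"
  by (simp add: word_mult_def)

lemma word_mult_Nil_left [simp]: "word_mult (bas []) x = x"
  by (simp add: word_mult_def fext_bas)

lemma word_mult_Nil_right [simp]: "word_mult x (bas []) = x"
  by (simp add: word_mult_def fext_bas)

lemma word_mult_assoc: "word_mult (word_mult x y) z = word_mult x (word_mult y z)"
proof (rule flin_eqI[where u = x])
  fix u
  show "word_mult (word_mult (bas u) y) z = word_mult (bas u) (word_mult y z)"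
  proof (rule flin_eqI[where u = y])
    fix v
    show "word_mult (word_mult (bas u) (bas v)) z = word_mult (bas u) (word_mult (bas v) z)"
    proof (rule flin_eqI[where u = z])
      fix w
      show "word_mult (word_mult (bas u) (bas v)) (bas w)
          = word_mult (bas u) (word_mult (bas v) (bas w))"
        by simp
    qed (intro flin_word_mult_left flin_word_mult_right flin_id)+
  qed (intro flin_word_mult_left flin_word_mult_right flin_id)+
qed (intro flin_word_mult_left flin_word_mult_right flin_id)+

definition word_comult ::
    "(nat list \<Rightarrow>\<^sub>0 'k::{comm_ring,comm_monoid_mult}) \<Rightarrow> ((nat list \<Rightarrow>\<^sub>0 'k) list \<Rightarrow>\<^sub>0 'k) set" where
  "word_comult x = tclass fscale 2 (fext (\<lambda>w. csum w (\<lambda>u v. bas [bas u, bas v])) x)"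

text \<open>The equation saying that the antipode is a left convolution inverse of the identity,
  solved for its last term, whose right factor is the empty word. Termination reflects the connected
  grading by interval length.\<close>

fun gen_antipode :: "nat \<Rightarrow> nat \<Rightarrow> (nat list \<Rightarrow>\<^sub>0 'k::{comm_ring,comm_monoid_mult})" where
  "gen_antipode i 0 = bas []"
| "gen_antipode i (Suc l)
    = - (\<Sum>m\<le>l. word_mult (gen_antipode i m) (bas (gen (i + m) (Suc l - m))))"

text \<open>The factors appear in reverse order because an antipode is an anti-homomorphism.\<close>

primrec word_antipode :: "nat list \<Rightarrow> (nat list \<Rightarrow>\<^sub>0 'k::{comm_ring,comm_monoid_mult})" where
  "word_antipode [] = bas []"
| "word_antipode (n # w) = word_mult (word_antipode w)
    (case prod_decode n of (i, l) \<Rightarrow> gen_antipode i (Suc l))"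

definition interval_hopf ::
    "('k::{comm_ring,comm_monoid_mult}, nat list \<Rightarrow>\<^sub>0 'k) hopf_data" where
  "interval_hopf = \<lparr>hscale = fscale, hmult = word_mult, hone = bas [], hcomult = word_comult,
     hcounit = (\<lambda>x. Poly_Mapping.lookup x []), hantipode = fext word_antipode,
     hcomp = (\<lambda>n. {x. \<forall>w\<in>Poly_Mapping.keys x. deg w = n})\<rparr>"

lemma interval_hopf_simps [simp]:
  "hscale interval_hopf = fscale" "hmult interval_hopf = word_mult" "hone interval_hopf = bas []"
  "hcomult interval_hopf = word_comult" "hcounit interval_hopf = (\<lambda>x. Poly_Mapping.lookup x [])"
  "hantipode interval_hopf = fext word_antipode"
  "hcomp interval_hopf = (\<lambda>n. {x. \<forall>w\<in>Poly_Mapping.keys x. deg w = n})"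
  by (simp_all add: interval_hopf_def)

section \<open>The coproduct in coordinates and its coassociativity\<close>

lemma word_comult_rep_in:
  "fext (\<lambda>w. csum w (\<lambda>u v. bas [bas u, bas v])) x \<in> word_sums 2"
  by (intro is_submodule_fext csum_in_submodule[OF is_submodule_word_sums] is_submodule_word_sums
      single_in_word_sums) simp

lemma word_comult_in: "word_comult x \<in> tensor_power fscale 2"
  unfolding word_comult_def by (intro tclass_in word_comult_rep_in)

lemma coord_word_comult: "coord (word_comult x) = fext (\<lambda>w. csum w (\<lambda>u v. bas [u, v])) x"
  unfolding word_comult_def trep_tclass(2)[OF word_comult_rep_in]
  by (simp add: flin_comp_fext[OF flin_fext] flin_csum[OF flin_fext])

lemma flin_coord_word_comult: "flin f \<Longrightarrow> flin (\<lambda>x. coord (word_comult (f x)))"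
  unfolding coord_word_comult by auto

lemma fext_coord_word_comult:
  "fext f (coord (word_comult x)) = fext (\<lambda>w. csum w (\<lambda>u v. f [u, v])) x"
  by (simp add: coord_word_comult flin_comp_fext[OF flin_fext] flin_csum[OF flin_fext])

lemma teval_word_comult:
  assumes "\<And>y. flin (\<lambda>x. f [x, y])" "\<And>x. flin (\<lambda>y. f [x, y])"
  shows "teval fscale f (word_comult x) = fext (\<lambda>w. csum w (\<lambda>u v. f [bas u, bas v])) x"
  using teval_coord[OF word_comult_in multilin_2[OF assms]] by (simp add: fext_coord_word_comult)

lemma coord_tmap_word_comult:
  assumes "\<And>x y. G [x, y] \<in> tensor_power fscale n"
    and "\<And>y. flin (\<lambda>x. coord (G [x, y]))" "\<And>x. flin (\<lambda>y. coord (G [x, y]))"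
  shows "tmap fscale n G (word_comult x) \<in> tensor_power fscale n"
    and "coord (tmap fscale n G (word_comult x))
      = fext (\<lambda>w. csum w (\<lambda>u v. coord (G [bas u, bas v]))) x"
proof -
  have G: "G hs \<in> tensor_power fscale n" if "length hs = 2" for hs
    using that assms(1) by (auto simp: numeral_eq_Suc length_Suc_conv)
  show "tmap fscale n G (word_comult x) \<in> tensor_power fscale n"
    using word_comult_in G by (rule tmap_in)
  show "coord (tmap fscale n G (word_comult x))
      = fext (\<lambda>w. csum w (\<lambda>u v. coord (G [bas u, bas v]))) x"
    using coord_tmap[OF word_comult_in G multilin_2[OF assms(2,3)]]
    by (simp add: fext_coord_word_comult)
qed

lemma
  shows totimes_comult_pure: "totimes fscale 3 (word_comult x) (pure fscale [y]) \<in> tensor_power fscale 3"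
      "coord (totimes fscale 3 (word_comult x) (pure fscale [y]))
        = fext (\<lambda>us. fext (\<lambda>vs. bas (us @ vs)) (coord1 [y])) (coord (word_comult x))"
    and totimes_pure_comult: "totimes fscale 3 (pure fscale [y]) (word_comult x) \<in> tensor_power fscale 3"
      "coord (totimes fscale 3 (pure fscale [y]) (word_comult x))
        = fext (\<lambda>us. fext (\<lambda>vs. bas (us @ vs)) (coord (word_comult x))) (coord1 [y])"
  using totimes_in[OF word_comult_in pure_in[of "[y]"], of 3 x] coord_totimes[OF word_comult_in pure_in[of "[y]"], of 3 x]
    totimes_in[OF pure_in[of "[y]"] word_comult_in, of 3 x] coord_totimes[OF pure_in[of "[y]"] word_comult_in, of 3 x]
  by (simp_all add: coord_pure)

lemma word_comult_coassoc:
  "tmap fscale 3 (\<lambda>hs. totimes fscale 3 (word_comult (hs ! 0)) (pure fscale [hs ! 1])) (word_comult x)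
   = tmap fscale 3 (\<lambda>hs. totimes fscale 3 (pure fscale [hs ! 0]) (word_comult (hs ! 1))) (word_comult x)"
  (is "?L = ?R")
proof (rule coord_inject)
  have lin: "flin (\<lambda>y. coord1 [y])" by auto
  let ?l = "\<lambda>hs. totimes fscale 3 (word_comult (hs ! 0)) (pure fscale [hs ! 1])"
  let ?r = "\<lambda>hs. totimes fscale 3 (pure fscale [hs ! 0]) (word_comult (hs ! 1))"
  have l: "?l [a, b] \<in> tensor_power fscale 3" "flin (\<lambda>a. coord (?l [a, b]))"
      "flin (\<lambda>b. coord (?l [a, b]))" for a b :: "nat list \<Rightarrow>\<^sub>0 'a"
    unfolding nth_Cons_0 nth_Cons_Suc One_nat_def totimes_comult_pure(2)
    by (intro totimes_comult_pure(1) flin_comp flin_fext_param flin_coord_word_comult lin flin_id)+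
  have r: "?r [a, b] \<in> tensor_power fscale 3" "flin (\<lambda>a. coord (?r [a, b]))"
      "flin (\<lambda>b. coord (?r [a, b]))" for a b :: "nat list \<Rightarrow>\<^sub>0 'a"
    unfolding nth_Cons_0 nth_Cons_Suc One_nat_def totimes_pure_comult(2)
    by (intro totimes_pure_comult(1) flin_comp flin_fext_param flin_coord_word_comult lin flin_id)+
  note L = coord_tmap_word_comult[of ?l, OF l] and R = coord_tmap_word_comult[of ?r, OF r]
  show "?L \<in> tensor_power fscale 3" by (rule L)
  show "?R \<in> tensor_power fscale 3" by (rule R)
  show "coord ?L = coord ?R"
    \<comment> \<open>In coordinates the two sides are the two ways of cutting a word twice.\<close>
    unfolding L(2) R(2)
    by (simp add: totimes_comult_pure(2) totimes_pure_comult(2) fext_coord_word_comult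
        csum_coassoc[of _ "\<lambda>a b c. bas [a, b, c]"])
qed

section \<open>The Hopf algebra structure\<close>

lemma csum_fscale: "csum w (\<lambda>u v. fscale c (f u v)) = fscale c (csum w f)"
  by (rule csum_hom[symmetric]) (auto simp: fscale_add)

lemma flin_csum_pt:
  assumes "\<And>u v. flin (\<lambda>x. f x u v)"
  shows "flin (\<lambda>x. csum w (f x))"
proof (rule flinI)
  fix x y c
  have "f (x + y) = (\<lambda>u v. f x u v + f y u v)"
    by (intro ext) (rule flin_add[OF assms])
  then show "csum w (f (x + y)) = csum w (f x) + csum w (f y)"
    by (simp add: csum_add)
  have "f (fscale c x) = (\<lambda>u v. fscale c (f x u v))"
    by (intro ext) (rule flin_fscale[OF assms])
  then show "csum w (f (fscale c x)) = fscale c (csum w (f x))"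
    by (simp add: csum_fscale)
qed

lemma csum_fext: "csum w (\<lambda>u v. fext (F u v) y) = fext (\<lambda>z. csum w (\<lambda>u v. F u v z)) y"
  unfolding lin_ext_def csum_sum csum_fscale ..

lemma word_comult_mult:
  "word_comult (word_mult x y)
    = tensor_square_mult interval_hopf (word_comult x) (word_comult y)"
proof -
  have pair: "coord1 [p, q] = fext (\<lambda>u. fext (\<lambda>v. bas [u, v]) q) p"
    for p q :: "nat list \<Rightarrow>\<^sub>0 'a" by (simp add: flin_comp_fext[OF flin_fext])
  have pair1: "flin (\<lambda>x. coord1 [f x, q])" and pair2: "flin (\<lambda>x. coord1 [q, f x])"
    if "flin f" for f :: "(nat list \<Rightarrow>\<^sub>0 'a) \<Rightarrow> (nat list \<Rightarrow>\<^sub>0 'a)" and q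
    unfolding pair by (intro flin_comp flin_fext_param that)+
  define G where "G xs ys = pure fscale [word_mult (xs ! 0) (ys ! 0), word_mult (xs ! 1) (ys ! 1)]"
    for xs ys :: "(nat list \<Rightarrow>\<^sub>0 'a) list"
  have G: "G [a, b] [c, d] \<in> tensor_power fscale 2"
    "coord (G [a, b] [c, d]) = coord1 [word_mult a c, word_mult b d]" for a b c d
    by (simp_all add: G_def coord_pure pure_in_length del: coord1.simps)
  have "flin (\<lambda>c. coord (G [a, b] [c, d]))" "flin (\<lambda>d. coord (G [a, b] [c, d]))" for a b c d
    unfolding G(2) by (intro pair1 pair2 flin_word_mult_right flin_id)+
  note inner = coord_tmap_word_comult[of "G [_, _]", OF G(1) this, unfolded G(2)]
  \<comment> \<open>The inner map of \<open>tensor_square_mult\<close>: multiplication by the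
    coproduct of \<open>y\<close>. It has to be shown linear in each entry before the outer map can
    be computed.\<close>
  define K where "K xs = tmap fscale 2 (G xs) (word_comult y)" for xs
  have K: "K [a, b] \<in> tensor_power fscale 2"
    "coord (K [a, b])
      = fext (\<lambda>w. csum w (\<lambda>c d. coord1 [word_mult a (bas c), word_mult b (bas d)])) y" for a b
    unfolding K_def by (rule inner)+
  have "flin (\<lambda>a. coord (K [a, b]))" "flin (\<lambda>b. coord (K [a, b]))" for a b
    unfolding K(2) by (intro flin_fext_param flin_csum_pt pair1 pair2 flin_word_mult_left flin_id)+
  note outer = coord_tmap_word_comult[of K, OF K(1) this, unfolded K(2)]
  have R: "tensor_square_mult interval_hopf (word_comult x) (word_comult y)
      = tmap fscale 2 K (word_comult x)"
    by (simp add: tensor_square_mult_def K_def[abs_def] G_def[abs_def])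
  have "coord (word_comult (word_mult x y))
      = fext (\<lambda>u. fext (\<lambda>v. csum (u @ v) (\<lambda>a b. bas [a, b])) y) x"
    by (simp add: coord_word_comult word_mult_def flin_comp_fext[OF flin_fext])
  also have "\<dots> = coord (tmap fscale 2 K (word_comult x))"
    \<comment> \<open>Interchanging the cuts of \<open>u\<close> with the expansion of
      \<open>y\<close> gives a double sum over cuts of \<open>u\<close> and \<open>v\<close>, which
      \<open>csum_append\<close> identifies with the cuts of \<open>u @ v\<close>.\<close>
    unfolding outer(2) csum_fext by (simp add: csum_append pair)
  finally show ?thesis
    unfolding R by (intro coord_inject[OF word_comult_in outer(1)])
qed

section \<open>The grading and its projections\<close>

definition deg_part ::
    "nat \<Rightarrow> (nat list \<Rightarrow>\<^sub>0 'k::{comm_ring,comm_monoid_mult}) \<Rightarrow> (nat list \<Rightarrow>\<^sub>0 'k)" where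
  "deg_part n = fext (\<lambda>w. if deg w = n then bas w else 0)"

lemma lookup_deg_part:
  "Poly_Mapping.lookup (deg_part n x) w = (if deg w = n then Poly_Mapping.lookup x w else 0)"
proof -
  have "Poly_Mapping.lookup (deg_part n x) w = (\<Sum>v\<in>Poly_Mapping.keys x.
      Poly_Mapping.lookup x v * (if v = w then if deg w = n then 1 else 0 else 0))"
    unfolding deg_part_def lookup_fext by (intro sum.cong) (auto simp: lookup_single when_def)
  then show ?thesis by (simp add: sum_keys_delta)
qed

text \<open>A word lies in a single component, so its coefficient in the sum comes only from the
  component of its own degree. This forces the decomposition and thereby identifies
  \<open>proj\<close>.\<close>

lemma homogeneous_decomp_iff:
  "homogeneous_decomp interval_hopf x f \<longleftrightarrow> (\<forall>n. Poly_Mapping.lookup f n = deg_part n x)"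
proof -
  let ?l = "\<lambda>n w. Poly_Mapping.lookup (Poly_Mapping.lookup f n) w"
  have "homogeneous_decomp interval_hopf x f \<longleftrightarrow>
      (\<forall>n w. deg w \<noteq> n \<longrightarrow> ?l n w = 0) \<and>
      (\<forall>w. Poly_Mapping.lookup x w = (\<Sum>n\<in>Poly_Mapping.keys f. ?l n w))"
  proof -
    have "(\<forall>n. Poly_Mapping.lookup f n \<in> hcomp interval_hopf n)
        \<longleftrightarrow> (\<forall>n w. deg w \<noteq> n \<longrightarrow> ?l n w = 0)"
      unfolding interval_hopf_simps mem_Collect_eq Ball_def in_keys_iff by blast
    moreover have "x = (\<Sum>n\<in>Poly_Mapping.keys f. Poly_Mapping.lookup f n)
        \<longleftrightarrow> (\<forall>w. Poly_Mapping.lookup x w = (\<Sum>n\<in>Poly_Mapping.keys f. ?l n w))"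
      by (simp add: poly_mapping_eq_iff fun_eq_iff lookup_sum)
    ultimately show ?thesis unfolding homogeneous_decomp_def by blast
  qed
  also have "\<dots> \<longleftrightarrow> (\<forall>n w. deg w \<noteq> n \<longrightarrow> ?l n w = 0) \<and>
      (\<forall>w. Poly_Mapping.lookup x w = ?l (deg w) w)"
  proof (intro conj_cong refl)
    assume *: "\<forall>n w. deg w \<noteq> n \<longrightarrow> ?l n w = 0"
    have "(\<Sum>n\<in>Poly_Mapping.keys f. ?l n w)
        = (\<Sum>n\<in>Poly_Mapping.keys f. if n = deg w then ?l (deg w) w else 0)" for w
      using * by (intro sum.cong) auto
    then have "(\<Sum>n\<in>Poly_Mapping.keys f. ?l n w) = ?l (deg w) w" for w
      by (auto simp: in_keys_iff)
    then show "(\<forall>w. Poly_Mapping.lookup x w = (\<Sum>n\<in>Poly_Mapping.keys f. ?l n w)) \<longleftrightarrow>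
        (\<forall>w. Poly_Mapping.lookup x w = ?l (deg w) w)" by simp
  qed
  also have "\<dots> \<longleftrightarrow> (\<forall>n. Poly_Mapping.lookup f n = deg_part n x)"
    by (auto simp: poly_mapping_eq_iff fun_eq_iff lookup_deg_part)
  finally show ?thesis .
qed

lemma homogeneous_decomp_unique: "\<exists>!f. homogeneous_decomp interval_hopf x f"
proof (rule ex_ex1I)
  \<comment> \<open>The monomials of \<open>x\<close>, collected by degree into one finitely
    supported map.\<close>
  let ?f = "\<Sum>w\<in>Poly_Mapping.keys x. Poly_Mapping.single (deg w)
    (Poly_Mapping.single w (Poly_Mapping.lookup x w))"
  have "homogeneous_decomp interval_hopf x ?f"
    unfolding homogeneous_decomp_iff
  proof (intro allI poly_mapping_eqI)
    fix n w
    have "Poly_Mapping.lookup (Poly_Mapping.lookup ?f n) w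
        = (\<Sum>v\<in>Poly_Mapping.keys x. if v = w then if deg w = n then Poly_Mapping.lookup x w else 0 else 0)"
      unfolding lookup_sum by (intro sum.cong) (auto simp: lookup_single when_def)
    then show "Poly_Mapping.lookup (Poly_Mapping.lookup ?f n) w
        = Poly_Mapping.lookup (deg_part n x) w"
      by (auto simp: lookup_deg_part in_keys_iff)
  qed
  then show "\<exists>f. homogeneous_decomp interval_hopf x f" ..
qed (simp add: homogeneous_decomp_iff poly_mapping_eqI)

lemma proj_interval_hopf: "proj interval_hopf n x = deg_part n x"
  using theI'[OF homogeneous_decomp_unique, of x] by (simp add: proj_def homogeneous_decomp_iff)

lemma word_mult_graded:
  assumes "\<forall>w\<in>Poly_Mapping.keys x. deg w = i" "\<forall>w\<in>Poly_Mapping.keys y. deg w = j"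
  shows "\<forall>w\<in>Poly_Mapping.keys (word_mult x y). deg w = i + j"
proof -
  have "word_mult x y \<in> {u. \<forall>w\<in>Poly_Mapping.keys u. deg w = i + j}"
    unfolding word_mult_def
    by (intro is_submodule_fext is_submodule_keys) (use assms in \<open>auto split: if_splits\<close>)
  then show ?thesis by simp
qed

section \<open>The antipode identities\<close>

lemma gen_antipode_graded:
  "\<forall>w\<in>Poly_Mapping.keys (gen_antipode i l :: _ \<Rightarrow>\<^sub>0 'k::{comm_ring,comm_monoid_mult}).
    deg w = deg (gen i l)"
proof (induction l rule: less_induct)
  case (less l)
  show ?case
  proof (cases l)
    case (Suc l')
    have "(\<Sum>m\<le>l'. word_mult (gen_antipode i m) (bas (gen (i + m) (Suc l' - m))))
      \<in> {u :: _ \<Rightarrow>\<^sub>0 'k. \<forall>w\<in>Poly_Mapping.keys u. deg w = deg (gen i l)}"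
    proof (intro is_submodule_sum[OF is_submodule_keys] CollectI)
      fix m assume "m \<in> {..l'}"
      then have m: "m < l" "m \<le> Suc l'" using Suc by auto
      show "\<forall>w\<in>Poly_Mapping.keys (word_mult (gen_antipode i m) (bas (gen (i + m) (Suc l' - m)))
          :: _ \<Rightarrow>\<^sub>0 'k). deg w = deg (gen i l)"
        unfolding Suc unfolding deg_gen_split[OF m(2), of i, symmetric]
        by (intro word_mult_graded less.IH m) (auto split: if_splits)
    qed
    then show ?thesis by (simp add: Suc)
  qed (auto split: if_splits)
qed

lemma word_antipode_gen_append:
  "word_antipode (gen i l @ w) = word_mult (word_antipode w) (gen_antipode i l)"
  by (cases l) (simp_all add: gen_Suc del: gen_antipode.simps(2))

lemma word_antipode_graded: "\<forall>v\<in>Poly_Mapping.keys (word_antipode w). deg v = deg w"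
proof (induction w rule: word_induct)
  case (gen i l w)
  show ?case unfolding word_antipode_gen_append deg_append add.commute[of "deg (gen _ _)"]
    by (intro word_mult_graded gen gen_antipode_graded)
qed (auto split: if_splits)

text \<open>For positive \<open>l\<close> this is the recursion with its left-hand side moved back
  into the sum as the term \<open>m = l\<close>.\<close>

lemma sum_gen_antipode_left:
  "(\<Sum>m\<le>l. word_mult (gen_antipode i m) (bas (gen (i + m) (l - m)))) = (if l = 0 then bas [] else 0)"
  by (cases l) (simp_all add: sum.atMost_Suc)

lemma word_mult_sum:
  "word_mult (sum f A) y = (\<Sum>a\<in>A. word_mult (f a) y)"
  "word_mult y (sum f A) = (\<Sum>a\<in>A. word_mult y (f a))"
  by (rule flin_sum, intro flin_word_mult_left flin_word_mult_right flin_id)+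

lemma word_mult_0 [simp]: "word_mult 0 y = 0" "word_mult y 0 = 0"
  using word_mult_sum[where A = "{}"] by auto

text \<open>A left convolution inverse S is also a right one. With * for convolution, id * (S * id)
  = id. Grouped as (id * S) * id, the same sum keeps only the terms \<open>t = 0\<close> and
  \<open>t = l\<close> by the induction hypothesis; the former already equals the interval, so the
  latter is zero.\<close>

lemma sum_gen_antipode_right:
  "(\<Sum>m\<le>l. word_mult (bas (gen i m)) (gen_antipode (i + m) (l - m)))
    = (if l = 0 then bas [] else (0 :: _ \<Rightarrow>\<^sub>0 'k::{comm_ring,comm_monoid_mult}))"
proof (induction l rule: less_induct)
  case (less l)
  let ?R = "\<lambda>t. \<Sum>m\<le>t. word_mult (bas (gen i m) :: _ \<Rightarrow>\<^sub>0 'k) (gen_antipode (i + m) (t - m))"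
  let ?F = "\<lambda>a b c. word_mult (word_mult (bas (gen i a) :: _ \<Rightarrow>\<^sub>0 'k) (gen_antipode (i + a) b))
    (bas (gen (i + a + b) c))"
  show ?case
  proof (cases "l = 0")
    case False
    have "(\<Sum>t\<le>l. word_mult (?R t) (bas (gen (i + t) (l - t))))
        = (\<Sum>t\<le>l. \<Sum>m\<le>t. ?F m (t - m) (l - t))"
      unfolding word_mult_sum by (intro sum.cong refl) simp
    also have "\<dots> = (\<Sum>m\<le>l. \<Sum>b\<le>l - m. ?F m b (l - m - b))"
      by (rule sum_interval_coassoc)
    also have "\<dots> = (\<Sum>m\<le>l. word_mult (bas (gen i m)) (if l - m = 0 then bas [] else 0))"
      unfolding word_mult_assoc word_mult_sum(2)[symmetric] sum_gen_antipode_left ..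
    also have "\<dots> = (\<Sum>m\<le>l. if m = l then bas (gen i l) else 0)"
      by (intro sum.cong) auto
    finally have 1: "(\<Sum>t\<le>l. word_mult (?R t) (bas (gen (i + t) (l - t)))) = bas (gen i l)"
      by simp
    have "(\<Sum>t<l. word_mult (?R t) (bas (gen (i + t) (l - t))))
        = (\<Sum>t<l. if t = 0 then bas (gen i l) else 0)"
      by (intro sum.cong refl) (simp add: less.IH)
    then have "(\<Sum>t<l. word_mult (?R t) (bas (gen (i + t) (l - t)))) = bas (gen i l)"
      using False by simp
    with 1 have "?R l = 0"
      by (simp add: lessThan_Suc_atMost[symmetric] add.commute del: lessThan_Suc_atMost)
    then show ?thesis using False by simp
  qed simp
qed

text \<open>Since the antipode reverses products, the two pieces of the first interval meet in the
  middle of the product, where \<open>sum_gen_antipode_left\<close> cancels them.\<close>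

lemma csum_antipode_left:
  "csum w (\<lambda>u v. word_mult (word_antipode u) (bas v)) = (if w = [] then bas [] else 0)"
proof (induction w rule: word_induct)
  case (gen i l w)
  have "csum (gen i (Suc l) @ w) (\<lambda>u v. word_mult (word_antipode u) (bas v))
    = csum w (\<lambda>u v. word_mult (word_antipode u) (word_mult
        (\<Sum>m\<le>Suc l. word_mult (gen_antipode i m) (bas (gen (i + m) (Suc l - m)))) (bas v)))"
    unfolding csum_gen_append csum_sum[symmetric] word_antipode_gen_append word_mult_sum
      word_mult_bas[symmetric] word_mult_assoc ..
  then show ?case by (simp add: sum_gen_antipode_left gen_neq_Nil)
qed simp

text \<open>Here the rest of the word sits in the middle and vanishes by induction unless it is
  empty; in that case only the interval remains, and \<open>sum_gen_antipode_right\<close>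
  applies.\<close>

lemma csum_antipode_right:
  "csum w (\<lambda>u v. word_mult (bas u) (word_antipode v)) 
    = (if w = [] then bas [] else (0 :: _ \<Rightarrow>\<^sub>0 'k::{comm_ring,comm_monoid_mult}))"
proof (induction w rule: word_induct)
  case (gen i l w)
  have "csum (gen i (Suc l) @ w) (\<lambda>u v. word_mult (bas u) (word_antipode v))
    = (\<Sum>m\<le>Suc l. word_mult (bas (gen i m) :: _ \<Rightarrow>\<^sub>0 'k) (word_mult
        (csum w (\<lambda>u v. word_mult (bas u) (word_antipode v))) (gen_antipode (i + m) (Suc l - m))))"
    by (simp only: csum_gen_append word_antipode_gen_append word_mult_assoc
      word_mult_bas[symmetric] flin_csum[OF flin_word_mult_left[OF flin_id]]
      flin_csum[OF flin_word_mult_right[OF flin_id]])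
  also have "\<dots> = 0"
  proof (cases "w = []")
    case True
    then show ?thesis using sum_gen_antipode_right[where l = "Suc l" and i = i] by simp
  qed (simp add: gen)
  finally show ?case by (simp add: gen_neq_Nil)
qed simp

section \<open>The counit and the remaining axioms\<close>

lemma flin_fscale_lookup: "flin (\<lambda>x. fscale (Poly_Mapping.lookup x w) y)"
  by (rule flinI) (simp_all add: lookup_add fscale_left_add)

lemma fext_if_Nil:
  "fext (\<lambda>w. if w = [] then y else 0) x = fscale (Poly_Mapping.lookup x []) y"
proof (rule poly_mapping_eqI)
  fix v
  show "Poly_Mapping.lookup (fext (\<lambda>w. if w = [] then y else 0) x) v
    = Poly_Mapping.lookup (fscale (Poly_Mapping.lookup x []) y) v"
    by (simp add: lookup_fext if_distrib[of "\<lambda>u. Poly_Mapping.lookup u _"] sum_keys_delta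
        cong: if_cong)
qed

text \<open>A concatenation is empty only if both factors are; this makes the counit
  multiplicative.\<close>

lemma lookup_word_mult_Nil:
  "Poly_Mapping.lookup (word_mult x y) [] = Poly_Mapping.lookup x [] * Poly_Mapping.lookup y []"
proof -
  have *: "Poly_Mapping.lookup (fext (\<lambda>w. bas (v @ w)) y) []
      = (if v = [] then Poly_Mapping.lookup y [] else 0)" for v
    by (cases "v = []") (simp_all add: fext_bas lookup_fext lookup_single when_def)
  show ?thesis unfolding word_mult_def lookup_fext[of _ x] * sum_keys_delta ..
qed

lemma word_comult_graded:
  fixes x :: "nat list \<Rightarrow>\<^sub>0 'k::{comm_ring,comm_monoid_mult}"
  assumes "\<forall>w\<in>Poly_Mapping.keys x. deg w = n"
  shows "word_comult x \<in> tensor_square_comp interval_hopf n"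
proof -
  let ?P = "\<lambda>hs :: (nat list \<Rightarrow>\<^sub>0 'k) list. \<exists>a b i j. hs = [a, b] \<and> a \<in> hcomp interval_hopf i \<and> b \<in> hcomp interval_hopf j \<and> i + j = n"
  have "fext (\<lambda>w. csum w (\<lambda>u v. bas [bas u, bas v])) x \<in> {u. \<forall>hs\<in>Poly_Mapping.keys u. ?P hs}"
  proof (intro is_submodule_fext csum_in_submodule[OF is_submodule_keys] is_submodule_keys CollectI ballI)
    fix w u v and hs :: "(nat list \<Rightarrow>\<^sub>0 'k) list"
    assume "w \<in> Poly_Mapping.keys x" "deg u + deg v = deg w"
      "hs \<in> Poly_Mapping.keys (bas [bas u, bas v] :: _ \<Rightarrow>\<^sub>0 'k)"
    then show "?P hs"
      using assms
      by (intro exI[of _ "bas u"] exI[of _ "bas v"] exI[of _ "deg u"] exI[of _ "deg v"])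
        (auto split: if_splits)
  qed
  then show ?thesis
    by (auto simp: tensor_square_comp_def word_comult_def)
qed

lemma graded_hopf_algebra_interval_hopf:
  "graded_hopf_algebra (interval_hopf :: ('k::{comm_ring,comm_monoid_mult}, _) hopf_data)"
proof -
  show ?thesis
  proof (unfold_locales, unfold interval_hopf_simps, unfold mem_Collect_eq)
    fix x y z :: "nat list \<Rightarrow>\<^sub>0 'k" and c n i j
    show "is_submodule fscale {x :: nat list \<Rightarrow>\<^sub>0 'k. \<forall>w\<in>Poly_Mapping.keys x. deg w = n}"
      by (rule is_submodule_keys)
    show "\<exists>!f. homogeneous_decomp interval_hopf x f"
      by (rule homogeneous_decomp_unique)
    show "word_mult (x + y) z = word_mult x z + word_mult y z"
      "word_mult (fscale c x) y = fscale c (word_mult x y)"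
      by (rule flin_add flin_fscale, rule flin_word_mult_left[OF flin_id])+
    show "word_mult x (y + z) = word_mult x y + word_mult x z"
      "word_mult x (fscale c y) = fscale c (word_mult x y)"
      by (rule flin_add flin_fscale, rule flin_word_mult_right[OF flin_id])+
    show "word_mult (word_mult x y) z = word_mult x (word_mult y z)"
      by (rule word_mult_assoc)
    show "\<forall>w\<in>Poly_Mapping.keys (word_mult x y). deg w = i + j"
      if "\<forall>w\<in>Poly_Mapping.keys x. deg w = i" "\<forall>w\<in>Poly_Mapping.keys y. deg w = j"
      using that by (rule word_mult_graded)
    show "word_comult x \<in> tensor_power fscale 2" by (rule word_comult_in)
    show "word_comult (x + y) = tadd fscale 2 (word_comult x) (word_comult y)"
      by (intro coord_inject[where n = 2] word_comult_in tadd_in)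
        (simp add: coord_tadd[OF word_comult_in word_comult_in]
          flin_add[OF flin_coord_word_comult[OF flin_id]])
    show "word_comult (fscale c x) = tscale fscale 2 c (word_comult x)"
      by (intro coord_inject[where n = 2] word_comult_in tscale_in)
        (simp add: coord_tscale[OF word_comult_in]
          flin_fscale[OF flin_coord_word_comult[OF flin_id]])
    show "tmap fscale 3 (\<lambda>hs. totimes fscale 3 (word_comult (hs ! 0)) (pure fscale [hs ! 1])) (word_comult x)
      = tmap fscale 3 (\<lambda>hs. totimes fscale 3 (pure fscale [hs ! 0]) (word_comult (hs ! 1))) (word_comult x)"
      by (rule word_comult_coassoc)
    \<comment> \<open>On basis words the counit tests for the empty word, which leads to
      \<open>csum_counit_left\<close>.\<close>
    have "teval fscale (\<lambda>hs. fscale (Poly_Mapping.lookup (hs ! 0) []) (hs ! 1)) (word_comult x)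
      = fext (\<lambda>w. csum w (\<lambda>u v. if u = [] then bas v else 0)) x"
      by (subst teval_word_comult)
        (auto simp: flin_fscale_lookup lookup_single when_def intro: flin_fscale_pt flin_id
          intro!: arg_cong[where f = "\<lambda>f. fext f x"] ext csum_cong)
    then show "teval fscale (\<lambda>hs. fscale (Poly_Mapping.lookup (hs ! 0) []) (hs ! 1)) (word_comult x) = x"
      by (simp add: csum_counit_left fext_bas)
    have "teval fscale (\<lambda>hs. fscale (Poly_Mapping.lookup (hs ! 1) []) (hs ! 0)) (word_comult x)
      = fext (\<lambda>w. csum w (\<lambda>u v. if v = [] then bas u else 0)) x"
      by (subst teval_word_comult)
        (auto simp: flin_fscale_lookup lookup_single when_def intro: flin_fscale_pt flin_id
          intro!: arg_cong[where f = "\<lambda>f. fext f x"] ext csum_cong)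
    then show "teval fscale (\<lambda>hs. fscale (Poly_Mapping.lookup (hs ! 1) []) (hs ! 0)) (word_comult x) = x"
      by (simp add: csum_counit_right fext_bas)
    show "word_comult x \<in> tensor_square_comp interval_hopf n"
      if "\<forall>w\<in>Poly_Mapping.keys x. deg w = n"
      using that by (rule word_comult_graded)
    show "Poly_Mapping.lookup x [] = 0" if "\<forall>w\<in>Poly_Mapping.keys x. deg w = n" "n \<noteq> 0"
      using that by (force simp: in_keys_iff)
    show "word_comult (word_mult x y)
      = tensor_square_mult interval_hopf (word_comult x) (word_comult y)"
      by (rule word_comult_mult)
    show "word_comult (bas [] :: nat list \<Rightarrow>\<^sub>0 'k) = pure fscale [bas [], bas []]"
      by (intro coord_inject[where n = 2] word_comult_in)
        (simp_all add: coord_pure coord_word_comult pure_in_length)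
    show "Poly_Mapping.lookup (word_mult x y) [] = Poly_Mapping.lookup x [] * Poly_Mapping.lookup y []"
      by (rule lookup_word_mult_Nil)
    have "teval fscale (\<lambda>hs. word_mult (fext word_antipode (hs ! 0)) (hs ! 1)) (word_comult x)
      = fext (\<lambda>w. csum w (\<lambda>u v. word_mult (word_antipode u) (bas v))) x"
      by (subst teval_word_comult) (auto intro: flin_word_mult_left flin_word_mult_right)
    then show "teval fscale (\<lambda>hs. word_mult (fext word_antipode (hs ! 0)) (hs ! 1)) (word_comult x)
      = fscale (Poly_Mapping.lookup x []) (bas [])"
      by (simp add: csum_antipode_left fext_if_Nil)
    have "teval fscale (\<lambda>hs. word_mult (hs ! 0) (fext word_antipode (hs ! 1))) (word_comult x)
      = fext (\<lambda>w. csum w (\<lambda>u v. word_mult (bas u) (word_antipode v))) x"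
      by (subst teval_word_comult) (auto intro: flin_word_mult_left flin_word_mult_right)
    then show "teval fscale (\<lambda>hs. word_mult (hs ! 0) (fext word_antipode (hs ! 1))) (word_comult x)
      = fscale (Poly_Mapping.lookup x []) (bas [])"
      by (simp add: csum_antipode_right fext_if_Nil)
    show "fext word_antipode (x + y) = fext word_antipode x + fext word_antipode y"
      "fext word_antipode (fscale c x) = fscale c (fext word_antipode x)"
      by (rule flin_add flin_fscale, rule flin_fext)+
    have "fext word_antipode x \<in> {u. \<forall>w\<in>Poly_Mapping.keys u. deg w = n}"
      if "\<forall>w\<in>Poly_Mapping.keys x. deg w = n"
      by (intro is_submodule_fext is_submodule_keys) (use that in \<open>auto dest: bspec[OF word_antipode_graded]\<close>)
    then show "\<forall>w\<in>Poly_Mapping.keys (fext word_antipode x). deg w = n"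
      if "\<forall>w\<in>Poly_Mapping.keys x. deg w = n"
      using that by blast
  qed (auto simp: lookup_add fscale_add fscale_left_add split: if_splits)
qed

section \<open>The endomorphisms on basis words\<close>

text \<open>The iterated coproduct of a word, with \<open>f\<close> applied to the resulting tuples.
  It starts from the counit at \<open>k = 0\<close>; the right counit law then yields
  \<open>f [w]\<close> at \<open>k = 1\<close>, in agreement with
  \<open>iter_comult\<close>.\<close>

primrec ksum :: "nat \<Rightarrow> nat list \<Rightarrow> (nat list list \<Rightarrow> 'm) \<Rightarrow> 'm::comm_monoid_add" where
  "ksum 0 w f = (if w = [] then f [] else 0)"
| "ksum (Suc k) w f = csum w (\<lambda>u v. ksum k v (\<lambda>vs. f (u # vs)))"

lemma flin_ksum: "flin g \<Longrightarrow> g (ksum k w f) = ksum k w (\<lambda>vs. g (f vs))"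
  by (induction k arbitrary: w f) (simp_all add: flin_zero flin_csum)

lemma ksum_cong:
  assumes "\<And>vs. length vs = k \<Longrightarrow> f vs = g vs"
  shows "ksum k w f = ksum k w g"
  using assms
proof (induction k arbitrary: w f g)
  case (Suc k)
  show ?case unfolding ksum.simps
    by (intro csum_cong Suc.IH Suc.prems) simp
qed simp

text \<open>Membership and coordinates are proved together because the coordinates of the tensor
  product can be computed only once its factors are known to be tensors.\<close>

lemma iter_comult_interval_hopf:
  fixes x :: "nat list \<Rightarrow>\<^sub>0 'k::{comm_ring,comm_monoid_mult}"
  shows "iter_comult interval_hopf k x \<in> tensor_power fscale k \<and>
    coord (iter_comult interval_hopf k x) = fext (\<lambda>w. ksum k w bas) x"
proof (induction "interval_hopf :: ('k, _) hopf_data" k x rule: iter_comult.induct)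
  case (1 x)
  have "pure fscale ([] :: (nat list \<Rightarrow>\<^sub>0 'k) list) \<in> tensor_power fscale 0"
    by (simp add: pure_in_length)
  from tscale_in[OF this] coord_tscale[OF this] show ?case
    by (simp add: coord_pure fext_if_Nil)
next
  case (2 x)
  then show ?case
    by (simp add: pure_in_length coord_pure csum_counit_right)
next
  case (3 k x)
  let ?A = "interval_hopf :: ('k, _) hopf_data"
  let ?G = "\<lambda>hs. totimes fscale (Suc (Suc k)) (pure fscale [hs ! 0])
    (iter_comult ?A (Suc k) (hs ! 1))"
  \<comment> \<open>The induction hypothesis speaks of \<open>hs ! 1\<close> for any list
    \<open>hs\<close>; a list with \<open>x\<close> at position 1 gives it for
    \<open>x\<close>.\<close>
  have IH: "iter_comult ?A (Suc k) x \<in> tensor_power fscale (Suc k)"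
    "coord (iter_comult ?A (Suc k) x) = fext (\<lambda>w. ksum (Suc k) w bas) x" for x
    using 3[of "[x, x]"] by auto
  have G: "?G [a, b] \<in> tensor_power fscale (Suc (Suc k))"
    "coord (?G [a, b]) = fext (\<lambda>us. fext (\<lambda>vs. bas (us @ vs))
      (fext (\<lambda>w. ksum (Suc k) w bas) b)) (coord1 [a])" for a b
    using totimes_in[OF pure_in[of "[a]"] IH(1), of "Suc (Suc k)" b]
      coord_totimes[OF pure_in[of "[a]"] IH(1), of "Suc (Suc k)" b]
    by (simp_all add: IH(2) coord_pure del: ksum.simps)
  have lin: "flin (\<lambda>y. coord1 [y])" by auto
  have "flin (\<lambda>a. coord (?G [a, b]))" "flin (\<lambda>b. coord (?G [a, b]))" for a b
    unfolding G(2) by (intro flin_comp flin_fext_param lin flin_fext)+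
  note T = coord_tmap_word_comult[of ?G, OF G(1) this, unfolded G(2), of x]
  have I: "iter_comult ?A (Suc (Suc k)) x = tmap fscale (Suc (Suc k)) ?G (word_comult x)"
    by simp
  show ?case
    unfolding I T(2) by (rule conjI[OF T(1)])
      (simp add: flin_ksum[OF flin_fext] flin_csum[OF flin_fext])
qed

section \<open>Permutations, projections and products in coordinates\<close>

lemma permute_list_update:
  assumes "\<sigma> permutes {..<length hs}" "i < length hs"
  shows "permute_list \<sigma> (hs[i := a]) = (permute_list \<sigma> hs)[inv \<sigma> i := a]"
proof (rule nth_equalityI)
  fix j assume "j < length (permute_list \<sigma> (hs[i := a]))"
  moreover have "\<sigma> j = i \<longleftrightarrow> inv \<sigma> i = j"
    using permutes_inv_eq[OF assms(1)] by blast
  moreover have "inv \<sigma> i < length hs"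
    using permutes_in_image[OF permutes_inv[OF assms(1)], of i] assms(2) by simp
  ultimately show "permute_list \<sigma> (hs[i := a]) ! j = (permute_list \<sigma> hs)[inv \<sigma> i := a] ! j"
    using assms permutes_in_image[OF assms(1), of j]
    by (auto simp: permute_list_nth nth_list_update)
qed simp

lemma
  assumes X: "X \<in> tensor_power fscale k" and \<sigma>: "\<sigma> permutes {..<k}"
  shows tensor_perm_in: "tensor_perm interval_hopf k (inv \<sigma>) X \<in> tensor_power fscale k"
    and coord_tensor_perm: "coord (tensor_perm interval_hopf k (inv \<sigma>) X)
      = fext (\<lambda>ws. bas (permute_list \<sigma> ws)) (coord X)"
proof -
  \<comment> \<open>The inverse in \<open>p_endo\<close> cancels the one in the definition of the
    action, so entries are rearranged by \<open>permute_list \<sigma>\<close>.\<close>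
  have inv: "inv (inv \<sigma>) = \<sigma>" using \<sigma> by (rule permutes_inv_inv)
  have G: "pure fscale (permute_list \<sigma> hs) \<in> tensor_power fscale k" if "length hs = k"
    for hs :: "(nat list \<Rightarrow>\<^sub>0 'a) list"
    using that by (intro pure_in_length) simp
  show "tensor_perm interval_hopf k (inv \<sigma>) X \<in> tensor_power fscale k"
    unfolding tensor_perm_def inv interval_hopf_simps using X G by (rule tmap_in)
  have "multilin k (\<lambda>hs :: (nat list \<Rightarrow>\<^sub>0 'a) list. coord1 (permute_list \<sigma> hs))"
  proof (rule multilin_updateI)
    fix hs :: "(nat list \<Rightarrow>\<^sub>0 'a) list" and i assume *: "length hs = k" "i < k"
    moreover have "inv \<sigma> i < k"
      using permutes_in_image[OF permutes_inv[OF \<sigma>], of i] *(2) by simp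
    ultimately show "flin (\<lambda>a. coord1 (permute_list \<sigma> (hs[i := a])))"
      using \<sigma> by (simp add: permute_list_update multilin_update[OF multilin_coord1])
  qed
  then have "coord (tensor_perm interval_hopf k (inv \<sigma>) X)
      = fext (\<lambda>ws. coord1 (permute_list \<sigma> (map bas ws))) (coord X)"
    using coord_tmap[where G = "\<lambda>hs. pure fscale (permute_list \<sigma> hs)", OF X G]
    unfolding tensor_perm_def inv interval_hopf_simps coord_pure by blast
  also have "\<dots> = fext (\<lambda>ws. bas (permute_list \<sigma> ws)) (coord X)"
    using \<sigma> coord_length[OF X]
    by (intro fext_cong) (simp add: permute_list_map coord1_bas)
  finally show "coord (tensor_perm interval_hopf k (inv \<sigma>) X)
      = fext (\<lambda>ws. bas (permute_list \<sigma> ws)) (coord X)" .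
qed

lemma flin_deg_part: "flin (deg_part n)"
  unfolding deg_part_def by (rule flin_fext)

lemma coord1_deg_part:
  "length \<alpha> = length ws \<Longrightarrow>
    coord1 (map2 deg_part \<alpha> (map bas ws)) = (if map deg ws = \<alpha> then bas ws else 0)"
  by (induction \<alpha> ws rule: list_induct2) (auto simp: deg_part_def)

lemma
  assumes X: "X \<in> tensor_power fscale (length \<alpha>)"
  shows tensor_proj_in: "tensor_proj interval_hopf \<alpha> X \<in> tensor_power fscale (length \<alpha>)"
    and coord_tensor_proj: "coord (tensor_proj interval_hopf \<alpha> X)
      = fext (\<lambda>ws. if map deg ws = \<alpha> then bas ws else 0) (coord X)"
proof -
  have proj: "proj (interval_hopf :: ('a, _) hopf_data) = deg_part"
    by (intro ext proj_interval_hopf)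
  have G: "pure fscale (map2 deg_part \<alpha> hs) \<in> tensor_power fscale (length \<alpha>)"
    if "length hs = length \<alpha>" for hs :: "(nat list \<Rightarrow>\<^sub>0 'a) list"
    using that by (intro pure_in_length) simp
  show "tensor_proj interval_hopf \<alpha> X \<in> tensor_power fscale (length \<alpha>)"
    unfolding tensor_proj_def proj interval_hopf_simps using X G by (rule tmap_in)
  have "multilin (length \<alpha>) (\<lambda>hs :: (nat list \<Rightarrow>\<^sub>0 'a) list. coord1 (map2 deg_part \<alpha> hs))"
  proof (rule multilin_updateI)
    fix hs :: "(nat list \<Rightarrow>\<^sub>0 'a) list" and i assume *: "length hs = length \<alpha>" "i < length \<alpha>"
    \<comment> \<open>The projections act entry by entry, so a change at \<open>i\<close> stays at
      \<open>i\<close> and passes through one linear map.\<close>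
    have "map2 deg_part \<alpha> (hs[i := a]) = (map2 deg_part \<alpha> hs)[i := deg_part (\<alpha> ! i) a]" for a
      using * by (intro nth_equalityI) (auto simp: nth_list_update)
    moreover have "flin (\<lambda>a. coord1 ((map2 deg_part \<alpha> hs)[i := a]))"
      by (rule multilin_update[OF multilin_coord1]) (use * in simp_all)
    ultimately show "flin (\<lambda>a. coord1 (map2 deg_part \<alpha> (hs[i := a])))"
      using flin_compose[OF _ flin_deg_part] by fastforce
  qed
  then have "coord (tensor_proj interval_hopf \<alpha> X)
      = fext (\<lambda>ws. coord1 (map2 deg_part \<alpha> (map bas ws))) (coord X)"
    using coord_tmap[where G = "\<lambda>hs. pure fscale (map2 deg_part \<alpha> hs)", OF X G]
    unfolding tensor_proj_def proj interval_hopf_simps coord_pure by blast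
  also have "\<dots> = fext (\<lambda>ws. if map deg ws = \<alpha> then bas ws else 0) (coord X)"
    using coord_length[OF X] by (intro fext_cong coord1_deg_part) simp
  finally show "coord (tensor_proj interval_hopf \<alpha> X)
      = fext (\<lambda>ws. if map deg ws = \<alpha> then bas ws else 0) (coord X)" .
qed

lemma iter_mult_interval_hopf:
  assumes "X \<in> tensor_power fscale k"
  shows "iter_mult interval_hopf X = fext (\<lambda>ws. bas (concat ws)) (coord X)"
proof -
  have "multilin k (\<lambda>hs :: (nat list \<Rightarrow>\<^sub>0 'a) list. foldr word_mult hs (bas []))"
  proof (rule multilinI)
    fix xs ys :: "(nat list \<Rightarrow>\<^sub>0 'a) list"
    show "flin (\<lambda>a. foldr word_mult (xs @ [a] @ ys) (bas []))"
      by (induction xs) (auto intro: flin_word_mult_left flin_word_mult_right)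
  qed
  moreover have "foldr word_mult (map bas ws) (bas []) = (bas (concat ws) :: _ \<Rightarrow>\<^sub>0 'a)" for ws
    by (induction ws) auto
  ultimately show ?thesis
    using teval_coord[OF assms] by (simp add: iter_mult_def)
qed

text \<open>The endomorphisms become sums over tuples of words; from here on the argument is
  combinatorial and tensor powers no longer appear.\<close>

lemma p_endo_bas:
  assumes "\<sigma> permutes {..<length \<alpha>}"
  shows "p_endo interval_hopf \<alpha> \<sigma> (bas w) = ksum (length \<alpha>) w (\<lambda>vs.
    if map deg (permute_list \<sigma> vs) = \<alpha> then bas (concat (permute_list \<sigma> vs)) else 0)"
proof -
  note I = iter_comult_interval_hopf[of "length \<alpha>" "bas w"]
  note P = tensor_perm_in[OF conjunct1[OF I] assms] coord_tensor_perm[OF conjunct1[OF I] assms]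
  note Q = tensor_proj_in[OF P(1)] coord_tensor_proj[OF P(1)]
  show ?thesis
    unfolding p_endo_def o_def iter_mult_interval_hopf[OF Q(1)] Q(2) P(2) conjunct2[OF I]
    by (auto simp: flin_ksum[OF flin_fext] intro!: ksum_cong)
qed

section \<open>Chains of intervals\<close>

text \<open>The adjacent intervals of the chain with start \<open>i\<close> and step lengths
  \<open>ms\<close>; a step of length 0 yields the empty word.\<close>

primrec gens :: "nat \<Rightarrow> nat list \<Rightarrow> nat list list" where
  "gens i [] = []"
| "gens i (m # ms) = gen i m # gens (i + m) ms"

lemma length_gens [simp]: "length (gens i ms) = length ms"
  by (induction ms arbitrary: i) auto

lemma gen_inject: "gen i m = gen i n \<longleftrightarrow> m = n"
  by (cases m; cases n) (auto simp: gen_def)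

text \<open>For an interval, \<open>ksum\<close> runs over the chains with \<open>k\<close> steps,
  zero steps allowed, and total length \<open>l\<close>. This lemma and the next extract what is
  needed without writing a sum over compositions.\<close>

lemma ksum_gen_zero:
  assumes "\<And>ns. length ns = k \<Longrightarrow> sum_list ns = l \<Longrightarrow> f (gens i ns) = 0"
  shows "ksum k (gen i l) f = 0"
  using assms
proof (induction k arbitrary: i l f)
  case 0
  then show ?case using 0[of "[]"] by (cases l) (auto simp: gen_neq_Nil)
next
  case (Suc k)
  have "ksum k (gen (i + m) (l - m)) (\<lambda>vs. f (gen i m # vs)) = 0" if "m \<le> l" for m
  proof (rule Suc.IH)
    fix ns assume "length ns = k" "sum_list ns = l - m"
    then show "f (gen i m # gens (i + m) ns) = 0"
      using Suc.prems[of "m # ns"] that by simp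
  qed
  then show ?case by (simp add: csum_gen)
qed

text \<open>After the first step is split off, \<open>ksum_gen_zero\<close> removes every first step
  other than \<open>m\<close>, and induction handles the rest.\<close>

lemma ksum_gen_single:
  assumes "\<And>ns. length ns = length ms \<Longrightarrow> sum_list ns = sum_list ms \<Longrightarrow> ns \<noteq> ms \<Longrightarrow> f (gens i ns) = 0"
  shows "ksum (length ms) (gen i (sum_list ms)) f = f (gens i ms)"
  using assms
proof (induction ms arbitrary: i f)
  case (Cons m ms)
  let ?l = "sum_list (m # ms)"
  let ?t = "\<lambda>a. ksum (length ms) (gen (i + a) (?l - a)) (\<lambda>vs. f (gen i a # vs))"
  have "?t a = 0" if "a \<le> ?l" "a \<noteq> m" for a
  proof (rule ksum_gen_zero)
    fix ns assume "length ns = length ms" "sum_list ns = ?l - a"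
    then show "f (gen i a # gens (i + a) ns) = 0"
      using Cons.prems[of "a # ns"] that by simp
  qed
  moreover have "?t m = f (gens i (m # ms))"
    using Cons.IH[of "\<lambda>vs. f (gen i m # vs)" "i + m"] Cons.prems[of "m # _"] by simp
  ultimately have "(\<Sum>a\<le>?l. ?t a) = (\<Sum>a\<le>?l. if a = m then f (gens i (m # ms)) else 0)"
    by (intro sum.cong) auto
  then show ?case by (simp add: csum_gen)
qed simp

section \<open>Strict chains and their permuted words\<close>

lemma gens_start:
  assumes "\<forall>m\<in>set ms. m > 0" "gen j m \<in> set (gens i ms)" "m > 0"
  shows "i \<le> j"
  using assms
proof (induction ms arbitrary: i)
  case (Cons n ms)
  then consider "gen j m = gen i n" | "gen j m \<in> set (gens (i + n) ms)" by auto
  then show ?case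
  proof cases
    case 1
    then show ?thesis using Cons.prems by (cases m; cases n) (auto simp: gen_def)
  next
    case 2
    then show ?thesis using Cons.IH[of "i + n"] Cons.prems by simp
  qed
qed simp

text \<open>After a positive first step all later intervals begin beyond \<open>i\<close>.\<close>

lemma gen_notin_gens:
  assumes "\<forall>m\<in>set ms. m > 0" "0 < m" "0 < n"
  shows "gen i m \<notin> set (gens (i + n) ms)"
  using gens_start[OF assms(1) _ assms(2), of i "i + n"] assms(3) by auto

lemma distinct_gens: "\<forall>m\<in>set ms. m > 0 \<Longrightarrow> distinct (gens i ms)"
  by (induction ms arbitrary: i) (auto simp: gen_notin_gens)

text \<open>The first interval is the only one that begins at \<open>i\<close>, so it can be
  recognised without knowing the order; removing it leaves a chain starting at its right
  endpoint.\<close>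

lemma gens_inject_mset:
  assumes "\<forall>m\<in>set ms. m > 0" "\<forall>n\<in>set ns. n > 0" "mset (gens i ms) = mset (gens i ns)"
  shows "ms = ns"
  using assms
proof (induction ms arbitrary: i ns)
  case Nil
  then show ?case by (cases ns) auto
next
  case (Cons m ms)
  then obtain n ns' where ns: "ns = n # ns'" by (cases ns) auto
  have "gen i m \<in> set (gens i ns)"
    using Cons.prems(3) by (metis gens.simps(2) list.set_intros(1) mset_eq_setD)
  \<comment> \<open>Otherwise \<open>gen i m\<close> would be one of the later intervals of
    \<open>ns\<close>.\<close>
  then have "m = n"
    using Cons.prems gen_notin_gens[of ns' m n i] by (auto simp: ns gen_inject)
  then show ?case using Cons.IH[of ns' "i + m"] Cons.prems by (simp add: ns)
qed

lemma length_gen: "length (gen i m) = (if m = 0 then 0 else 1)"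
  by (cases m) (auto simp: gen_def)

lemma length_concat_gens: "length (concat (gens i ms)) = length (filter (\<lambda>m. m \<noteq> 0) ms)"
  by (induction ms arbitrary: i) (auto simp: length_gen)

lemma in_set_gens_length: "\<forall>m\<in>set ms. m > 0 \<Longrightarrow> g \<in> set (gens i ms) \<Longrightarrow> length g = 1"
  by (induction ms arbitrary: i) (auto simp: length_gen)

lemma length_concat_permute_list:
  "\<sigma> permutes {..<length xs} \<Longrightarrow> length (concat (permute_list \<sigma> xs)) = length (concat xs)"
  unfolding length_concat
  by (metis mset_map mset_permute_list sum_mset_sum_list)

lemma permute_list_distinct_inject:
  assumes "distinct xs" "\<sigma> permutes {..<length xs}" "\<tau> permutes {..<length xs}"
    "permute_list \<sigma> xs = permute_list \<tau> xs"
  shows "\<sigma> = \<tau>"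
proof
  fix i
  show "\<sigma> i = \<tau> i"
  proof (cases "i < length xs")
    case True
    then have "xs ! \<sigma> i = xs ! \<tau> i"
      using assms by (metis permute_list_nth)
    then show ?thesis
      using assms(1) True permutes_in_image[OF assms(2), of i] permutes_in_image[OF assms(3), of i]
      by (simp add: nth_eq_iff_index_eq)
  next
    case False
    then show ?thesis using permutes_not_in[OF assms(2)] permutes_not_in[OF assms(3)] by simp
  qed
qed

text \<open>Zero steps contribute no letters, so \<open>ns\<close> can supply
  \<open>length ms\<close> letters only with exactly that many steps, all positive. Then every block
  is a single letter and the concatenations can be undone; the multiset of blocks gives the chain,
  and their distinctness gives the permutation.\<close>

lemma permuted_chain_unique:
  assumes "\<forall>m\<in>set ms. m > 0" "\<sigma> permutes {..<length ms}" "\<tau> permutes {..<length ns}"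
    "length ns \<le> length ms"
    and eq: "concat (permute_list \<tau> (gens i ns)) = concat (permute_list \<sigma> (gens i ms))"
  shows "ns = ms" "\<tau> = \<sigma>"
proof -
  have "length (filter (\<lambda>m. m \<noteq> 0) ns) = length (filter (\<lambda>m. m \<noteq> 0) ms)"
    using arg_cong[OF eq, of length] assms(2,3)
    by (simp add: length_concat_permute_list length_concat_gens)
  also have "filter (\<lambda>m. m \<noteq> 0) ms = ms"
    using assms(1) by (simp add: filter_id_conv)
  finally have len: "length (filter (\<lambda>m. m \<noteq> 0) ns) = length ms" .
  with assms(4) have "length ns = length ms" "\<not> length (filter (\<lambda>m. m \<noteq> 0) ns) < length ns"
    using length_filter_le[of "\<lambda>m. m \<noteq> 0" ns] by linarith+
  then have len: "length ns = length ms" and "0 \<notin> set ns"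
    using length_filter_less[of 0 ns "\<lambda>m. m \<noteq> 0"] by auto
  then have ns: "\<forall>m\<in>set ns. m > 0"
    by (metis not_gr_zero)
  have perm: "permute_list \<tau> (gens i ns) = permute_list \<sigma> (gens i ms)"
  proof (rule concat_injective[OF eq])
    have "length x = length y"
      if "(x, y) \<in> set (zip (permute_list \<tau> (gens i ns)) (permute_list \<sigma> (gens i ms)))" for x y
    proof -
      have "x \<in> set (gens i ns)" "y \<in> set (gens i ms)"
        using set_zip_leftD[OF that] set_zip_rightD[OF that] assms(2,3) by simp_all
      then show ?thesis
        using in_set_gens_length[OF ns, of x i] in_set_gens_length[OF assms(1), of y i] by simp
    qed
    then show "\<forall>(x, y)\<in>set (zip (permute_list \<tau> (gens i ns)) (permute_list \<sigma> (gens i ms))).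
        length x = length y" by blast
  qed (simp add: len)
  then have "mset (gens i ns) = mset (gens i ms)"
    using assms(2,3) by (metis length_gens mset_permute_list)
  then show "ns = ms"
    by (rule gens_inject_mset[OF ns assms(1)])
  with perm assms(2,3) show "\<tau> = \<sigma>"
    using permute_list_distinct_inject[OF distinct_gens[OF assms(1)], of \<tau> i \<sigma>] by simp
qed

text \<open>Among the indices no longer than the chain, the word of the permuted strict chain is
  seen only by the one with matching degrees and permutation. This is the triangularity behind
  linear independence.\<close>

lemma p_endo_chain_coeff:
  assumes ms: "\<forall>m\<in>set ms. m > 0" and \<sigma>: "\<sigma> permutes {..<length ms}"
    and \<tau>: "\<tau> permutes {..<length \<beta>}" and le: "length \<beta> \<le> length ms"
  shows "Poly_Mapping.lookup (p_endo interval_hopf \<beta> \<tau> (bas (gen i (sum_list ms))))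
      (concat (permute_list \<sigma> (gens i ms)))
    = (if \<beta> = map deg (permute_list \<sigma> (gens i ms)) \<and> \<tau> = \<sigma> then 1
      else (0 :: 'k::{comm_ring,comm_monoid_mult}))"
proof -
  let ?W = "concat (permute_list \<sigma> (gens i ms))"
  let ?f = "\<lambda>vs. if map deg (permute_list \<tau> vs) = \<beta> then bas (concat (permute_list \<tau> vs)) :: _ \<Rightarrow>\<^sub>0 'k else 0"
  let ?g = "\<lambda>vs. Poly_Mapping.lookup (?f vs) ?W"
  have lookup_ksum: "Poly_Mapping.lookup (ksum k w f) v = ksum k w (\<lambda>vs. Poly_Mapping.lookup (f vs) v)"
    for k w v and f :: "_ \<Rightarrow> nat list \<Rightarrow>\<^sub>0 'k"
    by (induction k arbitrary: w f)
      (auto simp: csum_hom[of "\<lambda>u. Poly_Mapping.lookup u v"] lookup_add)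
  have g: "?g (gens i ns) = (if ns = ms \<and> \<tau> = \<sigma> \<and> map deg (permute_list \<tau> (gens i ns)) = \<beta> then 1 else 0)"
    if "length ns = length \<beta>" for ns
    using permuted_chain_unique[OF ms \<sigma>, of \<tau> ns i] \<tau> le that
    by (auto simp: lookup_single when_def)
  have "Poly_Mapping.lookup (p_endo interval_hopf \<beta> \<tau> (bas (gen i (sum_list ms)))) ?W
      = ksum (length \<beta>) (gen i (sum_list ms)) ?g"
    by (simp only: p_endo_bas[OF \<tau>] lookup_ksum)
  also have "\<dots> = (if \<beta> = map deg (permute_list \<sigma> (gens i ms)) \<and> \<tau> = \<sigma> then 1 else 0)"
  proof (cases "length \<beta> = length ms")
    case True
    have "ksum (length \<beta>) (gen i (sum_list ms)) ?g = ?g (gens i ms)"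
      unfolding True
    proof (rule ksum_gen_single)
      fix ns assume "length ns = length ms" "ns \<noteq> ms"
      then show "?g (gens i ns) = 0" using True by (simp only: g) simp
    qed
    also have "\<dots> = (if \<beta> = map deg (permute_list \<sigma> (gens i ms)) \<and> \<tau> = \<sigma> then 1 else 0)"
      using True by (simp only: g) auto
    finally show ?thesis .
  next
    case False
    have "ksum (length \<beta>) (gen i (sum_list ms)) ?g = 0"
    proof (rule ksum_gen_zero)
      fix ns :: "nat list" assume ns: "length ns = length \<beta>"
      with False have "ns \<noteq> ms" by auto
      then show "?g (gens i ns) = 0" unfolding g[OF ns] by simp
    qed
    then show ?thesis using False by auto
  qed
  finally show ?thesis .
qed

text \<open>The chain visits points v^2 + t with t at most 2v, whose integer square root is v. A
  step of degree b goes to (v + b)^2 + t + 1: the square raises the root by b, and the increment of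
  t keeps the step positive even when b = 0. The premise leaves room for one increment per
  step.\<close>

lemma chain_with_degrees:
  assumes "t + length \<beta> \<le> 2 * v"
  shows "\<exists>ms. length ms = length \<beta> \<and> (\<forall>m\<in>set ms. m > 0) \<and> map deg (gens (v\<^sup>2 + t) ms) = \<beta>"
  using assms
proof (induction \<beta> arbitrary: v t)
  case (Cons b \<beta>)
  have sqrt: "floor_sqrt (u\<^sup>2 + s) = u" if "s \<le> 2 * u" for u s
    using that by (intro floor_sqrt_unique) (auto simp: power2_eq_square)
  obtain ms where ms: "length ms = length \<beta>" "\<forall>m\<in>set ms. m > 0"
      "map deg (gens ((v + b)\<^sup>2 + Suc t) ms) = \<beta>"
    using Cons.IH[of "Suc t" "v + b"] Cons.prems by auto
  define m where "m = (v + b)\<^sup>2 + Suc t - (v\<^sup>2 + t)"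
  have le: "v\<^sup>2 \<le> (v + b)\<^sup>2" by (simp add: power_mono)
  then have m: "m > 0" "v\<^sup>2 + t + m = (v + b)\<^sup>2 + Suc t"
    unfolding m_def by linarith+
  have "deg (gen (v\<^sup>2 + t) m) = b"
    unfolding deg_gen m(2) using Cons.prems sqrt[of t v] sqrt[of "Suc t" "v + b"] by simp
  moreover have "map deg (gens (v\<^sup>2 + t + m) ms) = \<beta>"
    unfolding m(2) by (rule ms(3))
  ultimately show ?case
    using ms(1,2) m(1) by (intro exI[of _ "m # ms"]) simp
qed simp

lemma chain_with_permuted_degrees:
  assumes "\<sigma> permutes {..<length \<alpha>}"
  obtains i ms where "length ms = length \<alpha>" "\<forall>m\<in>set ms. m > 0"
    "map deg (permute_list \<sigma> (gens i ms)) = \<alpha>"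
proof -
  \<comment> \<open>The degrees in chain order; permuting the finished chain by \<sigma> turns them
    back into \<alpha>.\<close>
  let ?\<beta> = "permute_list (inv \<sigma>) \<alpha>"
  \<comment> \<open>Starting at the square of \<open>length \<alpha>\<close> leaves room for
    \<open>2 * length \<alpha>\<close> increments, enough for all steps.\<close>
  obtain ms where ms: "length ms = length \<alpha>" "\<forall>m\<in>set ms. m > 0"
    "map deg (gens ((length \<alpha>)\<^sup>2 + 0) ms) = ?\<beta>"
    using chain_with_degrees[of 0 ?\<beta> "length \<alpha>"] by auto
  have "map deg (permute_list \<sigma> (gens ((length \<alpha>)\<^sup>2 + 0) ms)) = permute_list \<sigma> ?\<beta>"
    using assms ms by (simp add: permute_list_map[symmetric])
  also have "\<dots> = permute_list (inv \<sigma> \<circ> \<sigma>) \<alpha>"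
    using assms by (intro permute_list_compose[symmetric]) 
  also have "\<dots> = \<alpha>"
    using permutes_inv_o(2)[OF assms] by simp
  finally show ?thesis using ms that by blast
qed

section \<open>Linear independence\<close>

lemma sum_fun_apply: "(sum f A) x = (\<Sum>a\<in>A. f a x)"
  by (induction A rule: infinite_finite_induct) auto

lemma lin_indep_p_endo:
  "lin_indep (\<lambda>c f x. fscale c (f x)) {(k, \<alpha>, \<sigma>). length \<alpha> = k \<and> \<sigma> permutes {..<k}}
    (\<lambda>(k, \<alpha>, \<sigma>). p_endo (interval_hopf :: ('k::{comm_ring,comm_monoid_mult}, _) hopf_data) \<alpha> \<sigma>)"
  unfolding lin_indep_def
proof (intro allI impI, rule ccontr)
  fix F and c :: "_ \<Rightarrow> 'k"
  let ?p = "\<lambda>(k :: nat, \<alpha>, \<sigma>). p_endo (interval_hopf :: ('k, _) hopf_data) \<alpha> \<sigma>"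
  assume F: "finite F" "F \<subseteq> {(k, \<alpha>, \<sigma>). length \<alpha> = k \<and> \<sigma> permutes {..<k}}"
    and 0: "(\<Sum>i\<in>F. (\<lambda>x. fscale (c i) (?p i x))) = 0" and "\<not> (\<forall>i\<in>F. c i = 0)"
  \<comment> \<open>The longest index is taken only among those with nonzero coefficient; the others
    drop out of the sum whatever their length, so \<open>p_endo_chain_coeff\<close> covers all that
    remain.\<close>
  define F' where "F' = {i \<in> F. c i \<noteq> 0}"
  have F': "finite F'" "F' \<noteq> {}" using F \<open>\<not> _\<close> by (auto simp: F'_def)
  then obtain j where j: "j \<in> F'" "fst j = Max (fst ` F')"
    using Max_in[of "fst ` F'"] by (metis (no_types, lifting) finite_imageI image_iff image_is_empty)
  obtain \<alpha> \<sigma> where j_eq: "j = (length \<alpha>, \<alpha>, \<sigma>)" and \<sigma>: "\<sigma> permutes {..<length \<alpha>}"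
    using j(1) F(2) by (auto simp: F'_def)
  obtain i ms where ms: "length ms = length \<alpha>" "\<forall>m\<in>set ms. m > 0"
    and \<alpha>: "map deg (permute_list \<sigma> (gens i ms)) = \<alpha>"
    using chain_with_permuted_degrees[OF \<sigma>] by blast
  \<comment> \<open>The vanishing combination is evaluated at one interval, and the coefficient of
    one word is read off.\<close>
  let ?x = "bas (gen i (sum_list ms)) :: _ \<Rightarrow>\<^sub>0 'k" and ?W = "concat (permute_list \<sigma> (gens i ms))"
  have "c a * Poly_Mapping.lookup (?p a ?x) ?W = (if a = j then c j else 0)"
    if aF: "a \<in> F" for a
  proof (cases "c a = 0")
    case True
    then show ?thesis using j(1) by (auto simp: F'_def)
  next
    case False
    then have "a \<in> F'" using that by (simp add: F'_def)
    then have le: "fst a \<le> length \<alpha>"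
      using j(2) F'(1) by (simp add: j_eq)
    obtain \<beta> \<tau> where a: "a = (length \<beta>, \<beta>, \<tau>)" "\<tau> permutes {..<length \<beta>}"
      using subsetD[OF F(2) aF] by auto
    then show ?thesis
      using p_endo_chain_coeff[where 'k = 'k, of ms \<sigma> \<tau> \<beta> i] ms \<sigma> le by (auto simp: \<alpha> j_eq)
  qed
  then have "(\<Sum>a\<in>F. c a * Poly_Mapping.lookup (?p a ?x) ?W) = c j"
    using F(1) j(1) by (simp add: F'_def cong: sum.cong)
  moreover have "(\<Sum>a\<in>F. c a * Poly_Mapping.lookup (?p a ?x) ?W)
      = Poly_Mapping.lookup ((\<Sum>i\<in>F. (\<lambda>x. fscale (c i) (?p i x))) ?x) ?W"
    by (simp add: sum_fun_apply lookup_sum)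
  ultimately have "c j = 0" by (simp add: 0)
  then show False using j(1) by (simp add: F'_def)
qed

section \<open>Freeness of the graded components\<close>

lemma is_free_hcomp: "is_free fscale (hcomp (interval_hopf :: ('k::{comm_ring,comm_monoid_mult}, _) hopf_data) n)"
proof -
  let ?B = "bas ` {w. deg w = n} :: (nat list \<Rightarrow>\<^sub>0 'k) set"
  have "lin_indep fscale ?B (\<lambda>b. b)"
    unfolding lin_indep_def
  proof (intro allI impI ballI)
    fix F and c :: "_ \<Rightarrow> 'k" and b
    assume F: "finite F" "F \<subseteq> ?B" and 0: "(\<Sum>b\<in>F. fscale (c b) b) = 0" and b: "b \<in> F"
    then obtain w where w: "b = bas w" by auto
    \<comment> \<open>The coefficient at \<open>w\<close> isolates \<open>c b\<close>. Over the zero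
      ring, where all \<open>bas w\<close> coincide, both sides are 0.\<close>
    have "(\<Sum>a\<in>F. c a * Poly_Mapping.lookup a w) = (\<Sum>a\<in>F. if a = b then c b else 0)"
      using F(2) by (intro sum.cong) (auto simp: w lookup_single when_def)
    moreover have "(\<Sum>a\<in>F. c a * Poly_Mapping.lookup a w) = 0"
      using arg_cong[OF 0, of "\<lambda>u. Poly_Mapping.lookup u w"] by (simp add: lookup_sum)
    ultimately show "c b = 0" using F(1) b by simp
  qed
  moreover have "lin_span fscale ?B = {x. \<forall>w\<in>Poly_Mapping.keys x. deg w = n}"
  proof
    show "lin_span fscale ?B \<subseteq> {x. \<forall>w\<in>Poly_Mapping.keys x. deg w = n}"
      by (rule lin_span_least[OF is_submodule_keys]) (auto split: if_splits)
    show "{x. \<forall>w\<in>Poly_Mapping.keys x. deg w = n} \<subseteq> lin_span fscale ?B"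
    proof
      fix x :: "nat list \<Rightarrow>\<^sub>0 'k" assume "x \<in> {x. \<forall>w\<in>Poly_Mapping.keys x. deg w = n}"
      then have "fext bas x \<in> lin_span fscale ?B"
        by (intro is_submodule_fext is_submodule_lin_span lin_span_superset) auto
      then show "x \<in> lin_span fscale ?B" by (simp add: fext_bas)
    qed
  qed
  ultimately show ?thesis unfolding is_free_def interval_hopf_simps by blast
qed

theorem theorem1p37:
  shows "\<exists>A :: ('k::{comm_ring,comm_monoid_mult}, nat list \<Rightarrow>\<^sub>0 'k) hopf_data.
    graded_hopf_algebra A \<and>
    lin_indep (\<lambda>c f x. hscale A c (f x))
      {(k, \<alpha>, \<sigma>). length \<alpha> = k \<and> \<sigma> permutes {..<k}}
      (\<lambda>(k, \<alpha>, \<sigma>). p_endo A \<alpha> \<sigma>) \<and>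
    (\<forall>n. is_free (hscale A) (hcomp A n))"
proof (intro exI conjI allI)
  show "graded_hopf_algebra interval_hopf"
    by (rule graded_hopf_algebra_interval_hopf)
  show "lin_indep (\<lambda>c f x. hscale interval_hopf c (f x))
      {(k, \<alpha>, \<sigma>). length \<alpha> = k \<and> \<sigma> permutes {..<k}}
      (\<lambda>(k, \<alpha>, \<sigma>). p_endo interval_hopf \<alpha> \<sigma>)"
    unfolding interval_hopf_simps by (rule lin_indep_p_endo)
  show "is_free (hscale interval_hopf) (hcomp interval_hopf n)" for n
    unfolding interval_hopf_simps(1) by (rule is_free_hcomp)
qed

end
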